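(* Let the random variables satisfy assumption (U) and the single site potentials $(u_j)_{j\in\mathbb{Z}^d}$ satisfy assumption (No-Π) (both stated in the context), and let $H_\omega=-\Delta+V_\omega$ with $V_\omega=\sum_{j\in\mathbb{Z}^d}\pi_j(\omega)u_j$. For $L>0$ and $x\in\mathbb{R}^d$ let $H_{\omega,L,x}$ denote the restriction of $H_\omega$ to $\Lambda_L(x)$ with Dirichlet boundary conditions, and let $H_{0,L,0}$ denote the negative Dirichlet Laplacian on $\Lambda_L(0)$. Then for all $L\ge1$ and for any eigenvalue $E$ of $H_{0,L,0}$ there are infinitely many mutually disjoint cubes $\Lambda_L(x_j)$, $j\in\mathbb{N}$, such that for all $j \in \mathbb{N}$ and all configurations $\omega\in\Omega$ $$\sigma(H_{\omega,L,x_j})\cap[E-e^{-L},E+e^{-L}]\neq\emptyset.$$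
   Context: Thick sets: for $a=(a_1,\dots,a_d)\in(0,\infty)^d$ put $A_a:=[0,a_1]\times\cdots\times[0,a_d]\subset\mathbb{R}^d$. A measurable set $S\subset\mathbb{R}^d$ is thick if there exist $\gamma\in(0,1]$ and $a\in(0,\infty)^d$ with $\operatorname{vol}(S\cap(x+A_a))\ge\gamma\operatorname{vol}(A_a)$ for all $x\in\mathbb{R}^d$. Assumption (U): $[m_-,m_+]\subset\mathbb{R}$ is an interval and $\Omega=\prod_{j\in\mathbb{Z}^d}[m_-,m_+]$ is a probability space with product measure $\mathbb{P}=\bigotimes_{j\in\mathbb{Z}^d}\mu_j$, where the $\mu_j$ are probability measures on $[m_-,m_+]$. The coordinate projections $\pi_j:\Omega\to[m_-,m_+]$ are thus independent, uniformly bounded random variables. All $\pi_j$ are non-trivial (not almost surely constant). Assumption (No-Π): the functions $u_j:\mathbb{R}^d\to[0,\infty)$, $j\in\mathbb{Z}^d$, belong to $L^p(\mathbb{R}^d)$ (where $p\in[2,\infty)$, with $p>d/2$ if $d>3$), the function $U:=\sum_{j\in\mathbb{Z}^d}u_j$ satisfies $\|U\|_{L^\infty(\mathbb{R}^d)}\le C_U$ for some $C_U>0$, and for no $\kappa>0$ is the set $S_\kappa:=\{x\in\mathbb{R}^d: U(x)\ge\kappa\}$ thick. Notation: $\Lambda_L(x)=x+(-L/2,L/2)^d$; $\sigma(A)$ is the spectrum of $A$. *)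

theory Defs
  imports "HOL-Probability.Probability"
begin

definition thick :: "(real^'d) set \<Rightarrow> bool" where
  "thick S \<longleftrightarrow> S \<in> sets lebesgue \<and>
     (\<exists>\<gamma> a. 0 < \<gamma> \<and> \<gamma> \<le> 1 \<and> (\<forall>i. 0 < a $ i) \<and>
        (\<forall>x. measure lebesgue (S \<inter> (+) x ` cbox 0 a) \<ge> \<gamma> * measure lebesgue (cbox 0 a)))"

definition cube :: "real \<Rightarrow> real^'d \<Rightarrow> (real^'d) set" where
  "cube L x = (+) x ` box (vec (- (L / 2))) (vec (L / 2))"

text \<open>
  Elements of the complex Hilbert space \<open>L\<^sup>2(D)\<close> are represented by functions on the whole of
  \<open>\<real>\<^sup>d\<close> of which only the values almost everywhere in \<open>D\<close> matter. An unbounded operator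
  in \<open>L\<^sup>2(D)\<close> is represented by its graph, a set of pairs \<open>(u, f)\<close> closed under
  equality almost everywhere in both components.
\<close>

definition L2 :: "(real^'d) set \<Rightarrow> (real^'d \<Rightarrow> complex) set" where
  "L2 D = {f. f \<in> borel_measurable (lebesgue_on D) \<and>
              integrable (lebesgue_on D) (\<lambda>x. (cmod (f x))\<^sup>2)}"

definition L2_norm_on :: "(real^'d) set \<Rightarrow> (real^'d \<Rightarrow> complex) \<Rightarrow> real" where
  "L2_norm_on D f = sqrt (LINT x|lebesgue_on D. (cmod (f x))\<^sup>2)"

definition partial_deriv :: "'d \<Rightarrow> (real^'d \<Rightarrow> complex) \<Rightarrow> real^'d \<Rightarrow> complex" where
  "partial_deriv i f x = frechet_derivative f (at x) (axis i 1)"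

primrec times_differentiable :: "nat \<Rightarrow> (real^'d \<Rightarrow> complex) \<Rightarrow> bool" where
  "times_differentiable 0 f \<longleftrightarrow> continuous_on UNIV f"
| "times_differentiable (Suc k) f \<longleftrightarrow>
     (\<forall>x. f differentiable (at x)) \<and> (\<forall>i. times_differentiable k (partial_deriv i f))"

definition test_functions :: "(real^'d) set \<Rightarrow> (real^'d \<Rightarrow> complex) set" where
  "test_functions D = {\<phi>. (\<forall>k. times_differentiable k \<phi>) \<and>
      compact (closure {x. \<phi> x \<noteq> 0}) \<and> closure {x. \<phi> x \<noteq> 0} \<subseteq> D}"

text \<open>
  The Sobolev space \<open>H\<^sup>1\<^sub>0(D)\<close>, the closure of the test functions in the \<open>H\<^sup>1\<close>-norm. Its
  elements \<open>u\<close> are paired with their weak gradient \<open>g\<close>: the set below is the closure in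
  \<open>L\<^sup>2(D) \<times> L\<^sup>2(D)\<^sup>d\<close> of the graph of the gradient on test functions.
\<close>

definition H10_grad :: "(real^'d) set \<Rightarrow> ((real^'d \<Rightarrow> complex) \<times> ('d \<Rightarrow> real^'d \<Rightarrow> complex)) set" where
  "H10_grad D = {(u, g). u \<in> L2 D \<and> (\<forall>i. g i \<in> L2 D) \<and>
      (\<exists>\<phi>. (\<forall>n::nat. \<phi> n \<in> test_functions D) \<and>
           (\<lambda>n. L2_norm_on D (\<lambda>x. \<phi> n x - u x)) \<longlonglongrightarrow> 0 \<and>
           (\<forall>i. (\<lambda>n. L2_norm_on D (\<lambda>x. partial_deriv i (\<phi> n) x - g i x)) \<longlonglongrightarrow> 0))}"

text \<open>
  The negative Dirichlet Laplacian on \<open>D\<close> has domain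
  \<open>{u \<in> H\<^sup>1\<^sub>0(D). \<Delta> u \<in> L\<^sup>2(D)}\<close>, with \<open>\<Delta> u\<close> understood in the weak sense:
  \<open>- \<Delta> u = f\<close> iff \<open>\<integral> \<nabla> u \<cdot> cnj (\<nabla> \<phi>) = \<integral> f cnj \<phi>\<close> for all test functions \<open>\<phi>\<close>.
\<close>

definition neg_dirichlet_laplacian ::
    "(real^'d) set \<Rightarrow> ((real^'d \<Rightarrow> complex) \<times> (real^'d \<Rightarrow> complex)) set" where
  "neg_dirichlet_laplacian D = {(u, f). f \<in> L2 D \<and>
      (\<exists>g. (u, g) \<in> H10_grad D \<and>
           (\<forall>\<phi>\<in>test_functions D.
              (LINT x|lebesgue_on D. (\<Sum>i\<in>UNIV. g i x * cnj (partial_deriv i \<phi> x)))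
                = (LINT x|lebesgue_on D. f x * cnj (\<phi> x))))}"

text \<open>
  The operator sum \<open>- \<Delta> + V\<close>, on the set of all \<open>u\<close> in the domain of the Dirichlet Laplacian
  with \<open>V u \<in> L\<^sup>2(D)\<close>; the latter is automatic for essentially bounded \<open>V\<close>.
\<close>

definition dirichlet_schroedinger ::
    "(real^'d) set \<Rightarrow> (real^'d \<Rightarrow> real) \<Rightarrow> ((real^'d \<Rightarrow> complex) \<times> (real^'d \<Rightarrow> complex)) set" where
  "dirichlet_schroedinger D V = {(u, f). f \<in> L2 D \<and>
      (\<lambda>x. complex_of_real (V x) * u x) \<in> L2 D \<and>
      (\<exists>h. (u, h) \<in> neg_dirichlet_laplacian D \<and>
           (AE x in lebesgue_on D. f x = h x + complex_of_real (V x) * u x))}"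

text \<open>
  \<open>z\<close> is in the resolvent set of the operator with graph \<open>A\<close> iff \<open>A - z\<close> is a bijection
  from its domain onto \<open>L\<^sup>2(D)\<close> with bounded inverse.
\<close>

definition resolvent_set_of ::
    "(real^'d) set \<Rightarrow> ((real^'d \<Rightarrow> complex) \<times> (real^'d \<Rightarrow> complex)) set \<Rightarrow> complex set" where
  "resolvent_set_of D A = {z.
      (\<forall>(u, f)\<in>A. (AE x in lebesgue_on D. f x - z * u x = 0) \<longrightarrow> (AE x in lebesgue_on D. u x = 0)) \<and>
      (\<forall>h\<in>L2 D. \<exists>(u, f)\<in>A. AE x in lebesgue_on D. f x - z * u x = h x) \<and>
      (\<exists>C. \<forall>(u, f)\<in>A. L2_norm_on D u \<le> C * L2_norm_on D (\<lambda>x. f x - z * u x))}"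

definition spectrum_of ::
    "(real^'d) set \<Rightarrow> ((real^'d \<Rightarrow> complex) \<times> (real^'d \<Rightarrow> complex)) set \<Rightarrow> complex set" where
  "spectrum_of D A = - resolvent_set_of D A"

definition eigenvalue_of ::
    "(real^'d) set \<Rightarrow> ((real^'d \<Rightarrow> complex) \<times> (real^'d \<Rightarrow> complex)) set \<Rightarrow> complex \<Rightarrow> bool" where
  "eigenvalue_of D A z \<longleftrightarrow>
     (\<exists>(u, f)\<in>A. (AE x in lebesgue_on D. f x = z * u x) \<and> \<not> (AE x in lebesgue_on D. u x = 0))"

definition assumption_U :: "real \<Rightarrow> real \<Rightarrow> (int^'d \<Rightarrow> real measure) \<Rightarrow> bool" where
  "assumption_U m_minus m_plus \<mu> \<longleftrightarrow>
     (\<forall>j. prob_space (\<mu> j) \<and> sets (\<mu> j) = sets (restrict_space borel {m_minus..m_plus})) \<and>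
     (\<forall>j. \<not> (\<exists>c. AE \<omega> in Pi\<^sub>M UNIV \<mu>. \<omega> j = c))"

definition in_Lp :: "real \<Rightarrow> (real^'d \<Rightarrow> real) \<Rightarrow> bool" where
  "in_Lp p f \<longleftrightarrow> f \<in> borel_measurable lebesgue \<and> integrable lebesgue (\<lambda>x. \<bar>f x\<bar> powr p)"

text \<open>The sum is formed in \<open>[0, \<infinity>]\<close>, so that it makes sense at every point.\<close>

definition potential_sum :: "(int^'d \<Rightarrow> real^'d \<Rightarrow> real) \<Rightarrow> real^'d \<Rightarrow> ennreal" where
  "potential_sum u x = (\<Sum>\<^sub>\<infinity>j\<in>UNIV. ennreal (u j x))"

definition assumption_NoPi :: "real \<Rightarrow> (int^'d \<Rightarrow> real^'d \<Rightarrow> real) \<Rightarrow> bool" where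
  "assumption_NoPi p u \<longleftrightarrow>
     2 \<le> p \<and> (CARD('d) > 3 \<longrightarrow> p > real CARD('d) / 2) \<and>
     (\<forall>j x. 0 \<le> u j x) \<and> (\<forall>j. in_Lp p (u j)) \<and>
     (\<exists>C\<^sub>U>0. esssup lebesgue (potential_sum u) \<le> ennreal C\<^sub>U) \<and>
     (\<forall>\<kappa>>0. \<not> thick {x. potential_sum u x \<ge> ennreal \<kappa>})"

text \<open>
  The sum is absolutely convergent wherever \<open>potential_sum u\<close> is finite, hence almost everywhere
  under the assumptions above.
\<close>

definition random_potential :: "(int^'d \<Rightarrow> real^'d \<Rightarrow> real) \<Rightarrow> (int^'d \<Rightarrow> real) \<Rightarrow> real^'d \<Rightarrow> real" where
  "random_potential u \<omega> x = (\<Sum>\<^sub>\<infinity>j\<in>UNIV. \<omega> j * u j x)"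

end

theory Submission
  imports Defs
begin

text \<open>
  Fix an eigenfunction \<open>\<psi>\<close> of the Dirichlet Laplacian on \<open>\<Lambda>\<^sub>L(0)\<close> with eigenvalue \<open>E\<close>. As the
  sets \<open>S\<^sub>\<kappa> = {U \<ge> \<kappa>}\<close> are not thick, for every \<open>\<kappa>\<close> there are cubes \<open>\<Lambda>\<^sub>L(x)\<close>, arbitrarily far
  out, that \<open>S\<^sub>\<kappa>\<close> meets in arbitrarily small measure. There the translate of \<open>\<psi>\<close> satisfies
  \<open>\<parallel>(H\<^sub>\<omega> - E) \<psi>\<parallel> = \<parallel>V\<^sub>\<omega> \<psi>\<parallel> \<le> e\<^bsup>-L\<^esup> \<parallel>\<psi>\<parallel>\<close> for all \<open>\<omega>\<close> at once: outside \<open>S\<^sub>\<kappa>\<close> the potential is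
  small, and on \<open>S\<^sub>\<kappa>\<close> it is bounded while \<open>\<psi>\<close> carries little mass. For a symmetric operator
  such an approximate eigenfunction forces a spectral point within \<open>e\<^bsup>-L\<^esup>\<close> of \<open>E\<close>. The last step needs
  no spectral theorem: if \<open>E\<close> is in the resolvent set and \<open>M\<close> is the norm of the resolvent at
  \<open>E\<close>, then \<open>E + 1/M\<close> or \<open>E - 1/M\<close> is in the spectrum.
\<close>

section \<open>The Hilbert space of square-integrable functions\<close>

lemma L2_measurable: "f \<in> L2 D \<Longrightarrow> f \<in> borel_measurable (lebesgue_on D)"
  by (simp add: L2_def)

lemma L2_integrable_cmod_square:
  "f \<in> L2 D \<Longrightarrow> integrable (lebesgue_on D) (\<lambda>x. (cmod (f x))\<^sup>2)"
  by (simp add: L2_def)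

text \<open>The majorant \<open>w\<close> may be any integrable function. One domination argument
  thus covers sums, continuous functions of compact support and products with a potential.\<close>

lemma L2_dominated:
  assumes "f \<in> borel_measurable (lebesgue_on D)" "integrable (lebesgue_on D) w"
    and "AE x in lebesgue_on D. (cmod (f x))\<^sup>2 \<le> w x"
  shows "f \<in> L2 D"
proof -
  have "integrable (lebesgue_on D) (\<lambda>x. (cmod (f x))\<^sup>2)"
    by (rule Bochner_Integration.integrable_bound[OF assms(2)]) (use assms in auto)
  then show ?thesis using assms by (simp add: L2_def)
qed

lemma cmod_add_square_le: "(cmod (a + b))\<^sup>2 \<le> 2 * (cmod a)\<^sup>2 + 2 * (cmod b)\<^sup>2"
proof -
  have "(cmod (a + b))\<^sup>2 \<le> (cmod a + cmod b)\<^sup>2"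
    by (intro power_mono norm_triangle_ineq norm_ge_zero)
  also have "\<dots> \<le> 2 * (cmod a)\<^sup>2 + 2 * (cmod b)\<^sup>2"
    using sum_squares_bound[of "cmod a" "cmod b"] by (simp add: power2_sum)
  finally show ?thesis .
qed

lemma L2_add:
  assumes "f \<in> L2 D" "g \<in> L2 D"
  shows "(\<lambda>x. f x + g x) \<in> L2 D"
  by (rule L2_dominated[where w="\<lambda>x. 2 * (cmod (f x))\<^sup>2 + 2 * (cmod (g x))\<^sup>2"])
    (use assms cmod_add_square_le in \<open>auto simp: L2_def\<close>)

lemma L2_cmult:
  assumes "f \<in> L2 D"
  shows "(\<lambda>x. c * f x) \<in> L2 D"
  using assms by (auto simp: L2_def norm_mult power_mult_distrib)

lemma L2_diff:
  assumes "f \<in> L2 D" "g \<in> L2 D"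
  shows "(\<lambda>x. f x - g x) \<in> L2 D"
  using L2_add[OF assms(1) L2_cmult[OF assms(2), of "-1"]] by simp

lemma L2_integrable_mult_cnj:
  assumes "f \<in> L2 D" "g \<in> L2 D"
  shows "integrable (lebesgue_on D) (\<lambda>x. f x * cnj (g x))"
proof (rule Bochner_Integration.integrable_bound[where f="\<lambda>x. (cmod (f x))\<^sup>2 + (cmod (g x))\<^sup>2"])
  have "cmod a * cmod b \<le> (cmod a)\<^sup>2 + (cmod b)\<^sup>2" for a b
    using sum_squares_bound[of "cmod a" "cmod b"] mult_nonneg_nonneg[of "cmod a" "cmod b"]
    by (simp del: mult_nonneg_nonneg)
  then show "AE x in lebesgue_on D. norm (f x * cnj (g x)) \<le> norm ((cmod (f x))\<^sup>2 + (cmod (g x))\<^sup>2)"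
    by (auto simp: norm_mult)
  have [measurable]: "cnj \<in> borel_measurable borel"
    by (intro borel_measurable_continuous_onI continuous_intros)
  show "(\<lambda>x. f x * cnj (g x)) \<in> borel_measurable (lebesgue_on D)"
    using assms[THEN L2_measurable] by measurable
qed (use assms in \<open>auto simp: L2_def\<close>)

lemma L2_norm_on_nonneg [simp]: "0 \<le> L2_norm_on D f"
  by (simp add: L2_norm_on_def)

lemma L2_norm_on_square: "(L2_norm_on D f)\<^sup>2 = (LINT x|lebesgue_on D. (cmod (f x))\<^sup>2)"
  by (simp add: L2_norm_on_def)

lemma L2_norm_on_cong_AE:
  assumes "f \<in> borel_measurable (lebesgue_on D)" "g \<in> borel_measurable (lebesgue_on D)"
    and "AE x in lebesgue_on D. f x = g x"
  shows "L2_norm_on D f = L2_norm_on D g"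
  unfolding L2_norm_on_def
  by (intro arg_cong[where f=sqrt] integral_cong_AE) (use assms in auto)

lemma L2_norm_on_cmult: "L2_norm_on D (\<lambda>x. c * f x) = cmod c * L2_norm_on D f"
  by (simp add: L2_norm_on_def norm_mult power_mult_distrib real_sqrt_mult)

lemma L2_norm_on_eq_0_iff:
  assumes "f \<in> L2 D"
  shows "L2_norm_on D f = 0 \<longleftrightarrow> (AE x in lebesgue_on D. f x = 0)"
  using integral_nonneg_eq_0_iff_AE[OF L2_integrable_cmod_square[OF assms]]
  by (simp add: L2_norm_on_def)

lemma L2_norm_on_add_square:
  assumes "f \<in> L2 D" "g \<in> L2 D"
  shows "(L2_norm_on D (\<lambda>x. f x + g x))\<^sup>2 = (L2_norm_on D f)\<^sup>2
    + 2 * Re (LINT x|lebesgue_on D. f x * cnj (g x)) + (L2_norm_on D g)\<^sup>2"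
proof -
  note int = L2_integrable_mult_cnj[OF assms] assms[THEN L2_integrable_cmod_square]
  have "(cmod (a + b))\<^sup>2 = (cmod a)\<^sup>2 + 2 * Re (a * cnj b) + (cmod b)\<^sup>2" for a b
    unfolding cmod_power2 by (simp add: power2_eq_square algebra_simps)
  then have "(L2_norm_on D (\<lambda>x. f x + g x))\<^sup>2 =
    (LINT x|lebesgue_on D. (cmod (f x))\<^sup>2 + 2 * Re (f x * cnj (g x)) + (cmod (g x))\<^sup>2)"
    unfolding L2_norm_on_square by simp
  also have "\<dots> = (L2_norm_on D f)\<^sup>2
    + 2 * (LINT x|lebesgue_on D. Re (f x * cnj (g x))) + (L2_norm_on D g)\<^sup>2"
    using int integrable_Re[OF int(1)] unfolding L2_norm_on_square
    by (simp del: times_complex.simps)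
  also have "(LINT x|lebesgue_on D. Re (f x * cnj (g x))) = Re (LINT x|lebesgue_on D. f x * cnj (g x))"
    by (rule integral_Re[OF int(1)])
  finally show ?thesis .
qed

lemma L2_Cauchy_Schwarz:
  assumes "f \<in> L2 D" "g \<in> L2 D"
  shows "cmod (LINT x|lebesgue_on D. f x * cnj (g x)) \<le> L2_norm_on D f * L2_norm_on D g"
proof -
  let ?I = "LINT x|lebesgue_on D. cmod (f x) * cmod (g x)"
  let ?F = "L2_norm_on D f" and ?G = "L2_norm_on D g"
  have int: "integrable (lebesgue_on D) (\<lambda>x. cmod (f x) * cmod (g x))"
    using integrable_norm[OF L2_integrable_mult_cnj[OF assms]] by (simp add: norm_mult)
  \<comment> \<open>This is the expanded integral of a square. Passing to moduli makes the quadratic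
    form real and bounds the integral of \<open>cmod (f x) * cmod (g x)\<close>, so no phase has to
    be chosen.\<close>
  have quad: "0 \<le> s\<^sup>2 * ?F\<^sup>2 - 2 * s * t * ?I + t\<^sup>2 * ?G\<^sup>2" for s t :: real
  proof -
    have "0 \<le> (LINT x|lebesgue_on D. (s * cmod (f x) - t * cmod (g x))\<^sup>2)" by simp
    also have "\<dots> = (LINT x|lebesgue_on D. s\<^sup>2 * (cmod (f x))\<^sup>2 - 2 * s * t * (cmod (f x) * cmod (g x)) + t\<^sup>2 * (cmod (g x))\<^sup>2)"
      by (intro Bochner_Integration.integral_cong refl) (simp add: power2_eq_square algebra_simps)
    also have "\<dots> = s\<^sup>2 * ?F\<^sup>2 - 2 * s * t * ?I + t\<^sup>2 * ?G\<^sup>2"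
      using int assms[THEN L2_integrable_cmod_square] unfolding L2_norm_on_square by simp
    finally show ?thesis .
  qed
  have "?I \<le> ?F * ?G"
  proof (cases "?F * ?G = 0")
    case False
    then have "?F * ?G > 0"
      by (metis L2_norm_on_nonneg mult_nonneg_nonneg order_less_le)
    \<comment> \<open>The choice \<open>s = ?G\<close>, \<open>t = ?F\<close> makes the two square
      terms equal. Dividing by the positive product gives the claim; a vanishing product is treated
      apart.\<close>
    moreover have "0 \<le> 2 * (?F * ?G) * (?F * ?G - ?I)"
      using quad[of ?G ?F] by (simp add: power2_eq_square algebra_simps)
    ultimately show ?thesis by (simp add: zero_le_mult_iff)
  next
    case True
    then have "(AE x in lebesgue_on D. f x = 0) \<or> (AE x in lebesgue_on D. g x = 0)"
      using assms by (simp add: L2_norm_on_eq_0_iff)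
    then have "AE x in lebesgue_on D. cmod (f x) * cmod (g x) = 0" by (auto)
    then have "?I = 0" by (rule integral_eq_zero_AE)
    then show ?thesis by simp
  qed
  moreover have "cmod (LINT x|lebesgue_on D. f x * cnj (g x)) \<le> ?I"
    using integral_norm_bound[of "lebesgue_on D" "\<lambda>x. f x * cnj (g x)"] by (simp add: norm_mult)
  ultimately show ?thesis by simp
qed

lemma L2_norm_on_triangle:
  assumes "f \<in> L2 D" "g \<in> L2 D"
  shows "L2_norm_on D (\<lambda>x. f x + g x) \<le> L2_norm_on D f + L2_norm_on D g"
proof (rule power2_le_imp_le)
  have "Re (LINT x|lebesgue_on D. f x * cnj (g x)) \<le> L2_norm_on D f * L2_norm_on D g"
    using L2_Cauchy_Schwarz[OF assms] complex_Re_le_cmod order_trans by blast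
  then show "(L2_norm_on D (\<lambda>x. f x + g x))\<^sup>2 \<le> (L2_norm_on D f + L2_norm_on D g)\<^sup>2"
    unfolding L2_norm_on_add_square[OF assms] by (simp add: power2_sum)
qed simp

text \<open>Since \<open>c\<close> is real, conjugation leaves it unchanged and it can be pulled out
  of the cross term. With \<open>c\<close> equal to the square of a norm this computes the defect of
  a nearly norm-attaining vector.\<close>

lemma L2_norm_on_diff_square:
  assumes "f \<in> L2 D" "g \<in> L2 D"
  shows "(L2_norm_on D (\<lambda>x. f x - complex_of_real c * g x))\<^sup>2 = (L2_norm_on D f)\<^sup>2
    - 2 * c * Re (LINT x|lebesgue_on D. f x * cnj (g x)) + c\<^sup>2 * (L2_norm_on D g)\<^sup>2"
proof -
  have "(LINT x|lebesgue_on D. f x * cnj (- complex_of_real c * g x))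
      = - complex_of_real c * (LINT x|lebesgue_on D. f x * cnj (g x))"
    by (subst integral_mult_right_zero[symmetric]) (simp add: algebra_simps)
  then show ?thesis
    using L2_norm_on_add_square[OF assms(1) L2_cmult[OF assms(2), of "- complex_of_real c"]]
    unfolding L2_norm_on_cmult by (simp add: power_mult_distrib)
qed

section \<open>Approximate eigenvalues of symmetric relations\<close>

text \<open>By contradiction: let \<open>R\<close> be the resolvent at \<open>E\<close> and
  \<open>M\<close> its norm. The approximate eigenvector forces \<open>M\<close> to be at least
  \<open>1 / \<delta>\<close>, so \<open>E + 1 / M\<close> and \<open>E - 1 / M\<close> would both
  be resolvent points, and \<open>R - M\<close> and \<open>R + M\<close> would both be bounded
  below. Symmetry, however, makes their product small on vectors that nearly attain the norm of
  \<open>R\<close>. \<open>A\<close> is a relation because functions only represent classes modulo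
  null sets.\<close>

lemma symmetric_relation_spectrum_near:
  fixes A :: "((real^'d \<Rightarrow> complex) \<times> (real^'d \<Rightarrow> complex)) set" and E \<delta> :: real
  assumes L2: "\<And>u f. (u, f) \<in> A \<Longrightarrow> u \<in> L2 D \<and> f \<in> L2 D"
    and add: "\<And>u f v g. (u, f) \<in> A \<Longrightarrow> (v, g) \<in> A \<Longrightarrow> (\<lambda>x. u x + v x, \<lambda>x. f x + g x) \<in> A"
    and scale: "\<And>u f c. (u, f) \<in> A \<Longrightarrow> (\<lambda>x. c * u x, \<lambda>x. c * f x) \<in> A"
    and sym: "\<And>u f v g. (u, f) \<in> A \<Longrightarrow> (v, g) \<in> A \<Longrightarrow>
        (LINT x|lebesgue_on D. f x * cnj (v x)) = (LINT x|lebesgue_on D. u x * cnj (g x))"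
    and \<psi>: "(\<psi>, \<eta>) \<in> A" "L2_norm_on D \<psi> > 0"
      "L2_norm_on D (\<lambda>x. \<eta> x - complex_of_real E * \<psi> x) \<le> \<delta> * L2_norm_on D \<psi>"
  shows "spectrum_of D A \<inter> complex_of_real ` {E - \<delta> .. E + \<delta>} \<noteq> {}"
proof
  let ?N = "L2_norm_on D"
  assume empty: "spectrum_of D A \<inter> complex_of_real ` {E - \<delta> .. E + \<delta>} = {}"
  have res: "complex_of_real t \<in> resolvent_set_of D A" if "\<bar>t - E\<bar> \<le> \<delta>" for t
  proof -
    have "t \<in> {E - \<delta> .. E + \<delta>}" using that by (auto simp: abs_le_iff)
    with empty show ?thesis by (auto simp: spectrum_of_def)
  qed
  have bounded: "\<exists>C\<ge>0. \<forall>u f. (u, f) \<in> A \<longrightarrow> ?N u \<le> C * ?N (\<lambda>x. f x - complex_of_real t * u x)"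
    if t: "\<bar>t - E\<bar> \<le> \<delta>" for t
  proof -
    obtain C where C: "\<And>u f. (u, f) \<in> A \<Longrightarrow> ?N u \<le> C * ?N (\<lambda>x. f x - complex_of_real t * u x)"
      using res[OF t] unfolding resolvent_set_of_def by blast
    have "?N u \<le> \<bar>C\<bar> * ?N (\<lambda>x. f x - complex_of_real t * u x)" if "(u, f) \<in> A" for u f
      by (rule order_trans[OF C[OF that]]) (simp add: mult_right_mono)
    then show ?thesis by (intro exI[of _ "\<bar>C\<bar>"]) auto
  qed
  define Q :: "(real^'d \<Rightarrow> complex) \<Rightarrow> (real^'d \<Rightarrow> complex) \<Rightarrow> real^'d \<Rightarrow> complex"
    where "Q = (\<lambda>u f x. f x - complex_of_real E * u x)"
  have Q_L2: "Q u f \<in> L2 D" if "(u, f) \<in> A" for u f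
    unfolding Q_def using L2[OF that] by (intro L2_diff L2_cmult) auto
  have Q_scale: "?N (Q (\<lambda>x. c * u x) (\<lambda>x. c * f x)) = cmod c * ?N (Q u f)" for c u f
  proof -
    have "Q (\<lambda>x. c * u x) (\<lambda>x. c * f x) = (\<lambda>x. c * Q u f x)"
      by (simp add: Q_def algebra_simps)
    then show ?thesis by (simp add: L2_norm_on_cmult)
  qed
  \<comment> \<open>This places \<open>E\<close> itself in the interval, so that the resolvent at
    \<open>E\<close> is available.\<close>
  have \<delta>0: "0 \<le> \<delta>"
  proof (rule ccontr)
    assume "\<not> 0 \<le> \<delta>"
    then have "\<delta> * ?N \<psi> < 0" using \<psi>(2) by (simp add: mult_neg_pos)
    then show False
      using \<psi>(3) L2_norm_on_nonneg[of D "\<lambda>x. \<eta> x - complex_of_real E * \<psi> x"] by linarith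
  qed
  obtain C where C: "C \<ge> 0" "\<And>u f. (u, f) \<in> A \<Longrightarrow> ?N u \<le> C * ?N (Q u f)"
    using bounded[of E] \<delta>0 unfolding Q_def by auto
  have \<eta>pos: "?N (Q \<psi> \<eta>) > 0"
    using C(2)[OF \<psi>(1)] \<psi>(2) by (cases "?N (Q \<psi> \<eta>) = 0") (auto simp: less_le)
  \<comment> \<open>Writing \<open>h = Q u f\<close> and \<open>u = R h\<close>, the set
    \<open>B\<close> collects the norms of \<open>R h\<close> for \<open>h\<close> in the unit ball.
    Its supremum \<open>M\<close> is the operator norm of \<open>R\<close>.\<close>
  define B where "B = {?N u | u f. (u, f) \<in> A \<and> ?N (Q u f) \<le> 1}"
  define M where "M = Sup B"
  have B_bdd: "bdd_above B"
  proof (rule bdd_aboveI[of _ C])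
    fix y assume "y \<in> B"
    then obtain u f where y: "y = ?N u" "(u, f) \<in> A" "?N (Q u f) \<le> 1" by (auto simp: B_def)
    then show "y \<le> C" using C(2)[OF y(2)] mult_left_mono[OF y(3) C(1)] by simp
  qed
  have normalized: "?N u / ?N (Q u f) \<in> B" if "(u, f) \<in> A" "?N (Q u f) > 0" for u f
  proof -
    let ?c = "complex_of_real (1 / ?N (Q u f))"
    have "?N u / ?N (Q u f) = ?N (\<lambda>x. ?c * u x)"
      unfolding L2_norm_on_cmult using that(2) by (simp add: norm_divide)
    moreover have "?N (Q (\<lambda>x. ?c * u x) (\<lambda>x. ?c * f x)) \<le> 1"
      unfolding Q_scale using that(2) by (simp add: norm_divide)
    ultimately show ?thesis unfolding B_def using scale[OF that(1), of ?c] by blast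
  qed
  have M_bound: "?N u \<le> M * ?N (Q u f)" if uf: "(u, f) \<in> A" for u f
  proof (cases "?N (Q u f) = 0")
    \<comment> \<open>Normalizing would divide by zero here; the bound with \<open>C\<close> shows
      instead that \<open>u\<close> has norm zero.\<close>
    case True
    then show ?thesis using C(2)[OF uf] by simp
  next
    case False
    then have pos: "?N (Q u f) > 0" by (simp add: less_le)
    have "?N u / ?N (Q u f) \<le> M"
      unfolding M_def by (rule cSup_upper[OF normalized[OF uf pos] B_bdd])
    then show ?thesis using pos by (simp add: field_simps)
  qed
  have Mpos: "M > 0"
    using M_bound[OF \<psi>(1)] \<psi>(2) \<eta>pos by (metis less_le_trans zero_less_mult_pos2)
  \<comment> \<open>The approximate eigenvector enters here: it forces
    \<open>1 / M \<le> \<delta>\<close>, which keeps both points at distance \<open>1 / M\<close>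
    from \<open>E\<close> inside the interval.\<close>
  have "?N \<psi> \<le> M * ?N (Q \<psi> \<eta>)" by (rule M_bound[OF \<psi>(1)])
  also have "\<dots> \<le> M * (\<delta> * ?N \<psi>)"
    using \<psi>(3) Mpos unfolding Q_def by (intro mult_left_mono) auto
  finally have "?N \<psi> \<le> (M * \<delta>) * ?N \<psi>" by (simp only: mult.assoc)
  then have "1 \<le> M * \<delta>" using \<psi>(2) by simp
  then have M\<delta>: "1 / M \<le> \<delta>" using Mpos by (simp add: field_simps)
  obtain C1 where C1: "C1 \<ge> 0"
    "\<And>u f. (u, f) \<in> A \<Longrightarrow> ?N u \<le> C1 * ?N (\<lambda>x. f x - complex_of_real (E - 1 / M) * u x)"
    using bounded[of "E - 1 / M"] M\<delta> Mpos by auto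
  obtain C2 where C2: "C2 \<ge> 0"
    "\<And>u f. (u, f) \<in> A \<Longrightarrow> ?N u \<le> C2 * ?N (\<lambda>x. f x - complex_of_real (E + 1 / M) * u x)"
    using bounded[of "E + 1 / M"] M\<delta> Mpos by auto
  \<comment> \<open>\<open>K\<close> is the constant in \<open>?N u \<le> K * ?N w\<close> below.
    The bracket bounds \<open>y\<close> by \<open>w\<close>, passing through \<open>a\<close>; the
    factor \<open>C1 / M\<close> then bounds \<open>u\<close> by \<open>y\<close>.\<close>
  define K where "K = C1 / M * (1 / M + C2 / M\<^sup>2)"
  have K0: "K \<ge> 0" unfolding K_def using C1(1) C2(1) Mpos by simp
  txt \<open>
    With \<open>R\<close> the resolvent at \<open>E\<close> and \<open>u = R h\<close>, the vectors below are \<open>w = (R\<^sup>2 - M\<^sup>2) h\<close>,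
    \<open>y = (R + M) h\<close> and \<open>a = R y\<close>. If \<open>h\<close> almost attains the norm of \<open>R\<close> then \<open>w\<close> is small, so that
    the bounds at \<open>E + 1 / M\<close> and \<open>E - 1 / M\<close> make first \<open>a\<close> and \<open>y\<close>, then \<open>u\<close> small.
  \<close>
  have key: "(?N u)\<^sup>2 \<le> K\<^sup>2 * (2 * M\<^sup>2 * (M\<^sup>2 - (?N u)\<^sup>2))" if uf: "(u, f) \<in> A" and h1: "?N (Q u f) \<le> 1" for u f
  proof -
    define h where "h = Q u f"
    have uL: "u \<in> L2 D" and fL: "f \<in> L2 D" using L2[OF uf] by auto
    have hL: "h \<in> L2 D" unfolding h_def by (rule Q_L2[OF uf])
    \<comment> \<open>Surjectivity at \<open>E\<close> applied to \<open>u\<close> gives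
      \<open>v = R u = R (R h)\<close>, up to a null set.\<close>
    obtain v g where vg: "(v, g) \<in> A" and vgu: "AE x in lebesgue_on D. g x - complex_of_real E * v x = u x"
      using res[of E] \<delta>0 uL unfolding resolvent_set_of_def by fastforce
    have vL: "v \<in> L2 D" and gL: "g \<in> L2 D" using L2[OF vg] by auto
    have NR: "?N (Q v g) = ?N u"
      by (rule L2_norm_on_cong_AE) (use vgu Q_L2[OF vg] uL in \<open>auto simp: Q_def L2_measurable\<close>)
    have Nu: "?N u \<le> M" using M_bound[OF uf] h1 Mpos
      by (meson mult_left_le order_trans less_imp_le)
    have Nv: "?N v \<le> M\<^sup>2" using M_bound[OF vg] Nu Mpos unfolding NR power2_eq_square
      by (meson mult_left_mono order_trans less_imp_le)
    note int = L2_integrable_mult_cnj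
    \<comment> \<open>Symmetry moves \<open>A - E\<close> from \<open>u\<close> to \<open>v\<close>:
      the inner product of \<open>R (R h)\<close> with \<open>h\<close> is the squared norm of
      \<open>R h\<close>. The reality of \<open>E\<close> enters here.\<close>
    have "(LINT x|lebesgue_on D. v x * cnj (h x))
        = (LINT x|lebesgue_on D. v x * cnj (f x) - complex_of_real E * (v x * cnj (u x)))"
      by (simp add: h_def Q_def algebra_simps)
    also have "\<dots> = (LINT x|lebesgue_on D. g x * cnj (u x)) - complex_of_real E * (LINT x|lebesgue_on D. v x * cnj (u x))"
      using sym[OF vg uf] int[OF vL fL] int[OF vL uL] by simp
    also have "\<dots> = (LINT x|lebesgue_on D. g x * cnj (u x) - complex_of_real E * (v x * cnj (u x)))"
      using int[OF gL uL] int[OF vL uL] by simp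
    also have "\<dots> = (LINT x|lebesgue_on D. u x * cnj (u x))"
    proof (rule integral_cong_AE)
      show "AE x in lebesgue_on D. g x * cnj (u x) - complex_of_real E * (v x * cnj (u x)) = u x * cnj (u x)"
        using vgu by eventually_elim (metis left_diff_distrib mult.assoc)
    qed (use int[OF gL uL] int[OF vL uL] int[OF uL uL] in auto)
    also have "\<dots> = (LINT x|lebesgue_on D. complex_of_real ((cmod (u x))\<^sup>2))"
      by (simp add: complex_norm_square del: of_real_power)
    also have "\<dots> = complex_of_real ((?N u)\<^sup>2)"
      unfolding L2_norm_on_square by (rule integral_complex_of_real)
    finally have ip: "Re (LINT x|lebesgue_on D. v x * cnj (h x)) = (?N u)\<^sup>2" by simp
    define w where "w = (\<lambda>x. v x - complex_of_real (M\<^sup>2) * h x)"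
    have wL: "w \<in> L2 D" unfolding w_def by (intro L2_diff L2_cmult vL hL)
    \<comment> \<open>Since \<open>v\<close> has norm at most \<open>M\<^sup>2\<close> and
      \<open>h\<close> at most 1, the outer terms add up to at most \<open>2 * M ^ 4\<close>. The
      middle term nearly cancels this when the norm of \<open>u\<close> is close to
      \<open>M\<close>.\<close>
    have "(?N w)\<^sup>2 = (?N v)\<^sup>2 - 2 * M\<^sup>2 * (?N u)\<^sup>2 + (M\<^sup>2)\<^sup>2 * (?N h)\<^sup>2"
      unfolding w_def L2_norm_on_diff_square[OF vL hL] ip by simp
    also have "\<dots> \<le> (M\<^sup>2)\<^sup>2 - 2 * M\<^sup>2 * (?N u)\<^sup>2 + (M\<^sup>2)\<^sup>2 * 1"
      using power_mono[OF Nv, of 2] power_mono[OF h1, of 2] unfolding h_def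
      by (intro add_mono diff_mono mult_left_mono) auto
    finally have Nw: "(?N w)\<^sup>2 \<le> 2 * M\<^sup>2 * (M\<^sup>2 - (?N u)\<^sup>2)"
      by (simp add: algebra_simps power2_eq_square)
    define a where "a = (\<lambda>x. v x + complex_of_real M * u x)"
    define b where "b = (\<lambda>x. g x + complex_of_real M * f x)"
    have ab: "(a, b) \<in> A" unfolding a_def b_def by (intro add vg scale uf)
    have aL: "a \<in> L2 D" and bL: "b \<in> L2 D" using L2[OF ab] by auto
    \<comment> \<open>Here \<open>A - E\<close> sends \<open>a\<close> to \<open>u + M h\<close>.
      Subtracting \<open>a / M = v / M + u\<close> leaves \<open>M h - v / M\<close>, which is
      \<open>- w / M\<close>.\<close>
    have eq1: "AE x in lebesgue_on D. b x - complex_of_real (E + 1 / M) * a x = complex_of_real (- 1 / M) * w x"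
      using vgu
    proof eventually_elim
      case (elim x)
      have "b x - complex_of_real (E + 1 / M) * a x = (g x - complex_of_real E * v x) - u x
         + complex_of_real (- 1 / M) * w x"
        using Mpos by (simp add: a_def b_def w_def h_def Q_def field_simps power2_eq_square)
      then show ?case using elim by simp
    qed
    have Na: "?N a \<le> C2 * (1 / M * ?N w)"
    proof -
      have "?N (\<lambda>x. b x - complex_of_real (E + 1 / M) * a x) = ?N (\<lambda>x. complex_of_real (- 1 / M) * w x)"
        by (rule L2_norm_on_cong_AE)
          (use eq1 in \<open>auto intro!: L2_measurable L2_diff L2_cmult aL bL wL simp del: of_real_add of_real_divide of_real_minus\<close>)
      also have "\<dots> = 1 / M * ?N w" unfolding L2_norm_on_cmult using Mpos by (simp add: norm_divide)
      finally show ?thesis using C2(2)[OF ab] by simp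
    qed
    define y where "y = (\<lambda>x. u x + complex_of_real M * h x)"
    have yL: "y \<in> L2 D" unfolding y_def by (intro L2_add L2_cmult uL hL)
    \<comment> \<open>\<open>A - E + 1 / M\<close> sends \<open>u\<close> to
      \<open>h + u / M\<close>, which is \<open>y / M\<close>.\<close>
    have "(\<lambda>x. f x - complex_of_real (E - 1 / M) * u x) = (\<lambda>x. complex_of_real (1 / M) * y x)"
      using Mpos by (auto simp: y_def h_def Q_def field_simps)
    then have Nuy: "?N u \<le> C1 * (1 / M * ?N y)"
      using C1(2)[OF uf] Mpos by (simp add: L2_norm_on_cmult norm_divide del: of_real_divide)
    \<comment> \<open>\<open>y\<close> is the image of \<open>a\<close> under \<open>A - E\<close>;
      splitting off \<open>a / M\<close> leaves the term computed in \<open>eq1\<close>.\<close>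
    have "AE x in lebesgue_on D. y x = complex_of_real (- 1 / M) * w x + complex_of_real (1 / M) * a x"
      using eq1 vgu
    proof eventually_elim
      case (elim x)
      have "y x = (u x - (g x - complex_of_real E * v x))
          + (b x - complex_of_real (E + 1 / M) * a x) + complex_of_real (1 / M) * a x"
        using Mpos by (simp add: a_def b_def y_def h_def Q_def field_simps)
      then show ?case using elim by simp
    qed
    then have "?N y = ?N (\<lambda>x. complex_of_real (- 1 / M) * w x + complex_of_real (1 / M) * a x)"
      by (intro L2_norm_on_cong_AE L2_measurable L2_add L2_cmult aL wL yL)
    also have "\<dots> \<le> ?N (\<lambda>x. complex_of_real (- 1 / M) * w x) + ?N (\<lambda>x. complex_of_real (1 / M) * a x)"
      by (intro L2_norm_on_triangle L2_cmult aL wL)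
    also have "\<dots> = 1 / M * ?N w + 1 / M * ?N a"
      unfolding L2_norm_on_cmult using Mpos by (simp add: norm_divide)
    also have "\<dots> \<le> 1 / M * ?N w + 1 / M * (C2 * (1 / M * ?N w))"
      using Na Mpos by (intro add_left_mono mult_left_mono) auto
    also have "\<dots> = (1 / M + C2 / M\<^sup>2) * ?N w" by (simp add: field_simps power2_eq_square)
    finally have Ny: "?N y \<le> (1 / M + C2 / M\<^sup>2) * ?N w" .
    have "?N u \<le> C1 / M * ?N y" using Nuy by simp
    also have "\<dots> \<le> C1 / M * ((1 / M + C2 / M\<^sup>2) * ?N w)"
      using Ny C1(1) Mpos by (intro mult_left_mono) auto
    also have "\<dots> = K * ?N w" by (simp add: K_def)
    finally have "(?N u)\<^sup>2 \<le> (K * ?N w)\<^sup>2" by (intro power_mono) auto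
    also have "\<dots> \<le> K\<^sup>2 * (2 * M\<^sup>2 * (M\<^sup>2 - (?N u)\<^sup>2))"
      unfolding power_mult_distrib by (intro mult_left_mono Nw) auto
    finally show ?thesis .
  qed
  \<comment> \<open>The inequality \<open>key\<close> reads
    \<open>y\<^sup>2 \<le> q * (M\<^sup>2 - y\<^sup>2)\<close> for each \<open>y\<close> in
    \<open>B\<close>. It keeps \<open>B\<close> below a fixed fraction of \<open>M\<close>, the same
    for all \<open>y\<close>, against \<open>M\<close> being its supremum.\<close>
  define q where "q = 2 * K\<^sup>2 * M\<^sup>2"
  have q0: "q \<ge> 0" by (simp add: q_def)
  have "M \<le> M * sqrt (q / (1 + q))"
    unfolding M_def
  proof (rule cSup_least)
    show "B \<noteq> {}" using normalized[OF \<psi>(1) \<eta>pos] by auto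
    fix y assume "y \<in> B"
    then obtain u f where y: "y = ?N u" "(u, f) \<in> A" "?N (Q u f) \<le> 1" by (auto simp: B_def)
    have "y\<^sup>2 * (1 + q) \<le> M\<^sup>2 * q"
      using key[OF y(2,3)] unfolding y(1) q_def by (simp add: algebra_simps)
    then have "y\<^sup>2 \<le> M\<^sup>2 * (q / (1 + q))" using q0 by (simp add: field_simps)
    then have "sqrt (y\<^sup>2) \<le> sqrt (M\<^sup>2 * (q / (1 + q)))" by (rule real_sqrt_le_mono)
    then show "y \<le> Sup B * sqrt (q / (1 + q))"
      using Mpos unfolding real_sqrt_mult y(1) M_def[symmetric] by simp
  qed
  then have "1 \<le> sqrt (q / (1 + q))" using Mpos by simp
  then have "1 \<le> q / (1 + q)" by simp
  then show False using q0 by (simp add: field_simps)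
qed

section \<open>Symmetry of the Dirichlet operators\<close>

lemma times_differentiable_all_differentiable:
  "\<forall>k. times_differentiable k f \<Longrightarrow> f differentiable (at x)"
  by (metis times_differentiable.simps(2))

lemma times_differentiable_all_partial_deriv:
  "\<forall>k. times_differentiable k f \<Longrightarrow> \<forall>k. times_differentiable k (partial_deriv i f)"
  by (metis times_differentiable.simps(2))

lemma times_differentiable_all_continuous:
  "\<forall>k. times_differentiable k f \<Longrightarrow> continuous_on UNIV f"
  by (metis times_differentiable.simps(1))

lemma partial_deriv_add:
  assumes "f differentiable (at x)" "g differentiable (at x)"
  shows "partial_deriv i (\<lambda>y. f y + g y) x = partial_deriv i f x + partial_deriv i g x"
proof -
  have "((\<lambda>y. f y + g y) has_derivative (\<lambda>h. frechet_derivative f (at x) h + frechet_derivative g (at x) h)) (at x)"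
    using assms by (intro has_derivative_add) (simp_all add: frechet_derivative_works)
  from frechet_derivative_at[OF this] show ?thesis
    unfolding partial_deriv_def by metis
qed

lemma partial_deriv_cmult:
  assumes "f differentiable (at x)"
  shows "partial_deriv i (\<lambda>y. c * f y) x = c * partial_deriv i f x"
proof -
  have "((\<lambda>y. c * f y) has_derivative (\<lambda>h. c * frechet_derivative f (at x) h)) (at x)"
    using assms by (intro has_derivative_mult_right) (simp add: frechet_derivative_works)
  from frechet_derivative_at[OF this] show ?thesis
    unfolding partial_deriv_def by metis
qed

lemma partial_deriv_shift:
  assumes "f differentiable (at (x + a))"
  shows "partial_deriv i (\<lambda>y. f (y + a)) x = partial_deriv i f (x + a)"
proof -
  have "((\<lambda>y. f (y + a)) has_derivative frechet_derivative f (at (x + a))) (at x)"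
    by (rule has_derivative_compose[of "\<lambda>y. y + a" "\<lambda>h. h" x UNIV f])
      (use assms in \<open>auto intro!: derivative_eq_intros simp: frechet_derivative_works\<close>)
  from frechet_derivative_at[OF this] show ?thesis
    unfolding partial_deriv_def by metis
qed

lemma times_differentiable_add:
  "times_differentiable k f \<Longrightarrow> times_differentiable k g \<Longrightarrow> times_differentiable k (\<lambda>x. f x + g x)"
proof (induction k arbitrary: f g)
  case (Suc k)
  have "partial_deriv i (\<lambda>x. f x + g x) = (\<lambda>x. partial_deriv i f x + partial_deriv i g x)" for i
    using Suc.prems by (auto simp: partial_deriv_add)
  then show ?case using Suc by auto
qed (auto intro: continuous_intros)

lemma times_differentiable_cmult:
  "times_differentiable k f \<Longrightarrow> times_differentiable k (\<lambda>x. c * f x)"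
proof (induction k arbitrary: f)
  case (Suc k)
  have "partial_deriv i (\<lambda>x. c * f x) = (\<lambda>x. c * partial_deriv i f x)" for i
    using Suc.prems by (auto simp: partial_deriv_cmult)
  then show ?case using Suc by auto
qed (auto intro: continuous_intros)

lemma times_differentiable_shift:
  fixes a :: "real^'d"
  shows "times_differentiable k f \<Longrightarrow> times_differentiable k (\<lambda>x. f (x + a))"
proof (induction k arbitrary: f)
  case (Suc k)
  have "partial_deriv i (\<lambda>x. f (x + a)) = (\<lambda>x. partial_deriv i f (x + a))" for i
    using Suc.prems by (auto simp: partial_deriv_shift)
  moreover have "(\<lambda>x. f (x + a)) differentiable (at x)" for x
    using Suc.prems differentiable_compose[of f "\<lambda>x. x + a" x UNIV] by auto
  ultimately show ?case using Suc by auto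
next
  case 0
  then have "continuous_on UNIV f" by simp
  then have "continuous_on UNIV (\<lambda>x. f (x + a))"
    by (rule continuous_on_compose2) (auto intro: continuous_intros)
  then show ?case by simp
qed

section \<open>Test functions and their square-integrability\<close>

lemma test_functions_differentiable:
  "\<phi> \<in> test_functions D \<Longrightarrow> \<phi> differentiable (at x)"
  unfolding test_functions_def by (blast intro: times_differentiable_all_differentiable)

lemma test_functions_add:
  assumes "\<phi> \<in> test_functions D" "\<psi> \<in> test_functions D"
  shows "(\<lambda>x. \<phi> x + \<psi> x) \<in> test_functions D"
proof -
  let ?K = "closure {x. \<phi> x \<noteq> 0} \<union> closure {x. \<psi> x \<noteq> 0}"
  have "{x. \<phi> x + \<psi> x \<noteq> 0} \<subseteq> {x. \<phi> x \<noteq> 0} \<union> {x. \<psi> x \<noteq> 0}" by auto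
  from closure_mono[OF this] have sub: "closure {x. \<phi> x + \<psi> x \<noteq> 0} \<subseteq> ?K"
    by (simp only: closure_Un)
  have "compact ?K"
    using assms by (intro compact_Un) (auto simp: test_functions_def)
  then have "compact (?K \<inter> closure {x. \<phi> x + \<psi> x \<noteq> 0})"
    by (rule compact_Int_closed) (rule closed_closure)
  moreover have "?K \<inter> closure {x. \<phi> x + \<psi> x \<noteq> 0} = closure {x. \<phi> x + \<psi> x \<noteq> 0}"
    using sub by blast
  ultimately have "compact (closure {x. \<phi> x + \<psi> x \<noteq> 0})" by simp
  moreover have "?K \<subseteq> D" using assms by (simp add: test_functions_def)
  moreover have "times_differentiable k (\<lambda>x. \<phi> x + \<psi> x)" for k
    using assms by (intro times_differentiable_add) (auto simp: test_functions_def)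
  ultimately show ?thesis
    using sub unfolding test_functions_def by blast
qed

lemma test_functions_cmult:
  assumes "\<phi> \<in> test_functions D"
  shows "(\<lambda>x. c * \<phi> x) \<in> test_functions D"
\<comment> \<open>For \<open>c = 0\<close> the support becomes empty; otherwise it is exactly the
  support of \<phi>.\<close>
proof (cases "c = 0")
  case True
  have "\<forall>k. times_differentiable k (\<lambda>x. c * \<phi> x)"
    using assms times_differentiable_cmult unfolding test_functions_def by blast
  then show ?thesis using True by (simp add: test_functions_def)
next
  case False
  then show ?thesis
    using assms by (simp add: test_functions_def times_differentiable_cmult)
qed

text \<open>Off its closed support \<open>f\<close> vanishes on an open set, so its derivative is
  zero there. The support of a test function thus also serves for its partial derivatives.\<close>

lemma partial_deriv_support:
  assumes "x \<notin> closure {x. f x \<noteq> 0}"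
  shows "partial_deriv i f x = 0"
proof -
  have 0: "f y = 0" if "y \<in> - closure {x. f x \<noteq> 0}" for y
    using that closure_subset[of "{x. f x \<noteq> 0}"] by auto
  have "((\<lambda>x. 0 :: complex) has_derivative (\<lambda>h. 0)) (at x)" by simp
  then have "(f has_derivative (\<lambda>h. 0)) (at x)"
  proof (rule has_derivative_transform_within_open)
    show "open (- closure {x. f x \<noteq> 0})" by (intro open_Compl closed_closure)
    show "x \<in> - closure {x. f x \<noteq> 0}" using assms by simp
    show "0 = f y" if "y \<in> - closure {x. f x \<noteq> 0}" for y using 0[OF that] by (rule sym)
  qed
  from frechet_derivative_at[OF this] show ?thesis
    unfolding partial_deriv_def by metis
qed

text \<open>\<open>f\<close> is bounded by some \<open>B\<close> on the compact set, so its squared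
  modulus lies below \<open>B\<^sup>2\<close> times the indicator of a set of finite
  measure.\<close>

lemma continuous_compact_support_L2:
  assumes D: "D \<in> sets lebesgue" and f: "continuous_on UNIV f" and K: "compact K"
    and 0: "\<And>x. x \<notin> K \<Longrightarrow> f x = 0"
  shows "f \<in> L2 D"
proof -
  have "bounded (f ` K)"
    by (intro compact_imp_bounded compact_continuous_image K continuous_on_subset[OF f]) auto
  then obtain B where B: "\<And>x. x \<in> K \<Longrightarrow> cmod (f x) \<le> B" by (auto simp: bounded_iff)
  have fm: "f \<in> borel_measurable lebesgue"
    using borel_measurable_continuous_onI[OF f] by (simp add: measurable_completion)
  have Kl: "K \<in> lmeasurable" using K by (rule lmeasurable_compact)
  have w: "integrable (lebesgue_on D) (\<lambda>x. B\<^sup>2 * indicator K x :: real)"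
  proof -
    have "integrable lebesgue (\<lambda>x. B\<^sup>2 * indicator K x :: real)"
      using integrable_real_indicator[of K lebesgue] Kl
      by (intro integrable_mult_right) (auto simp: fmeasurable_def)
    then have "integrable lebesgue (\<lambda>x. indicator D x *\<^sub>R (B\<^sup>2 * indicator K x) :: real)"
      by (rule Bochner_Integration.integrable_bound)
        (use Kl D in \<open>auto simp: fmeasurable_def indicator_def\<close>)
    moreover have "D \<inter> space lebesgue \<in> sets lebesgue" using D by simp
    ultimately show ?thesis by (simp only: integrable_restrict_space)
  qed
  show ?thesis
  proof (rule L2_dominated[OF _ w])
    show "f \<in> borel_measurable (lebesgue_on D)"
      by (rule measurable_restrict_space1[OF fm])
    show "AE x in lebesgue_on D. (cmod (f x))\<^sup>2 \<le> B\<^sup>2 * indicator K x"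
      using B 0 by (intro AE_I2) (auto simp: indicator_def intro!: power_mono)
  qed
qed

lemma test_functions_L2:
  assumes "D \<in> sets lebesgue" "\<phi> \<in> test_functions D"
  shows "\<phi> \<in> L2 D" "partial_deriv i \<phi> \<in> L2 D"
proof -
  have \<phi>: "\<forall>k. times_differentiable k \<phi>" "compact (closure {x. \<phi> x \<noteq> 0})"
    using assms(2) by (auto simp: test_functions_def)
  show "\<phi> \<in> L2 D"
    by (rule continuous_compact_support_L2[OF assms(1) times_differentiable_all_continuous[OF \<phi>(1)] \<phi>(2)])
      (use closure_subset[of "{x. \<phi> x \<noteq> 0}"] in auto)
  show "partial_deriv i \<phi> \<in> L2 D"
    by (rule continuous_compact_support_L2[OF assms(1) _ \<phi>(2)])
      (auto intro!: partial_deriv_support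
        times_differentiable_all_continuous[OF times_differentiable_all_partial_deriv[OF \<phi>(1)]])
qed

section \<open>The Dirichlet form and Green's identity\<close>

lemma L2_inner_tendsto:
  assumes f: "f \<in> L2 D" and \<phi>: "\<And>n::nat. \<phi> n \<in> L2 D" and v: "v \<in> L2 D"
    and lim: "(\<lambda>n. L2_norm_on D (\<lambda>x. \<phi> n x - v x)) \<longlonglongrightarrow> 0"
  shows "(\<lambda>n. LINT x|lebesgue_on D. f x * cnj (\<phi> n x)) \<longlonglongrightarrow> (LINT x|lebesgue_on D. f x * cnj (v x))"
proof (rule metric_tendsto_imp_tendsto)
  show "(\<lambda>n. L2_norm_on D f * L2_norm_on D (\<lambda>x. \<phi> n x - v x)) \<longlonglongrightarrow> 0"
    using tendsto_mult_right_zero[OF lim] .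
  show "\<forall>\<^sub>F n in sequentially. dist (LINT x|lebesgue_on D. f x * cnj (\<phi> n x)) (LINT x|lebesgue_on D. f x * cnj (v x))
      \<le> dist (L2_norm_on D f * L2_norm_on D (\<lambda>x. \<phi> n x - v x)) 0"
  proof (intro always_eventually allI)
    fix n
    have "(LINT x|lebesgue_on D. f x * cnj (\<phi> n x)) - (LINT x|lebesgue_on D. f x * cnj (v x))
      = (LINT x|lebesgue_on D. f x * cnj (\<phi> n x - v x))"
      by (subst Bochner_Integration.integral_diff[symmetric])
        (auto simp: algebra_simps intro!: L2_integrable_mult_cnj f \<phi> v)
    then show "dist (LINT x|lebesgue_on D. f x * cnj (\<phi> n x)) (LINT x|lebesgue_on D. f x * cnj (v x))
      \<le> dist (L2_norm_on D f * L2_norm_on D (\<lambda>x. \<phi> n x - v x)) 0"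
      using L2_Cauchy_Schwarz[OF f L2_diff[OF \<phi>[of n] v]] by (simp add: dist_norm)
  qed
qed

lemma H10_grad_L2: "(u, g) \<in> H10_grad D \<Longrightarrow> u \<in> L2 D \<and> g i \<in> L2 D"
  by (auto simp: H10_grad_def)

lemma neg_dirichlet_laplacian_L2: "(u, f) \<in> neg_dirichlet_laplacian D \<Longrightarrow> u \<in> L2 D \<and> f \<in> L2 D"
  by (auto simp: neg_dirichlet_laplacian_def H10_grad_def)

text \<open>Both sides of the weak equation are continuous, by Cauchy-Schwarz, in the test function
  and its gradient, and \<open>H10_grad D\<close> is the closure of these pairs. The sum stands
  outside the integral so that limits can be taken component by component.\<close>

lemma dirichlet_form_extends_to_H10:
  assumes D: "D \<in> sets lebesgue" and f: "f \<in> L2 D" and g: "\<And>i. g i \<in> L2 D"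
    and weak: "\<And>\<phi>. \<phi> \<in> test_functions D \<Longrightarrow>
      (LINT x|lebesgue_on D. (\<Sum>i\<in>UNIV. g i x * cnj (partial_deriv i \<phi> x)))
        = (LINT x|lebesgue_on D. f x * cnj (\<phi> x))"
    and vk: "(v, k) \<in> H10_grad D"
  shows "(\<Sum>i\<in>UNIV. LINT x|lebesgue_on D. g i x * cnj (k i x)) = (LINT x|lebesgue_on D. f x * cnj (v x))"
proof -
  obtain \<phi> where \<phi>: "\<And>n::nat. \<phi> n \<in> test_functions D"
    "(\<lambda>n. L2_norm_on D (\<lambda>x. \<phi> n x - v x)) \<longlonglongrightarrow> 0"
    "\<And>i. (\<lambda>n. L2_norm_on D (\<lambda>x. partial_deriv i (\<phi> n) x - k i x)) \<longlonglongrightarrow> 0"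
    using vk unfolding H10_grad_def by blast
  note L = test_functions_L2[OF D \<phi>(1)]
  have "(\<lambda>n. \<Sum>i\<in>UNIV. LINT x|lebesgue_on D. g i x * cnj (partial_deriv i (\<phi> n) x))
      \<longlonglongrightarrow> (\<Sum>i\<in>UNIV. LINT x|lebesgue_on D. g i x * cnj (k i x))"
    by (intro tendsto_sum L2_inner_tendsto g L \<phi>(3)) (use H10_grad_L2[OF vk] in auto)
  moreover have "(\<Sum>i\<in>UNIV. LINT x|lebesgue_on D. g i x * cnj (partial_deriv i (\<phi> n) x))
      = (LINT x|lebesgue_on D. f x * cnj (\<phi> n x))" for n
    by (subst weak[OF \<phi>(1), symmetric], subst Bochner_Integration.integral_sum)
      (auto intro!: L2_integrable_mult_cnj g L)
  moreover have "(\<lambda>n. LINT x|lebesgue_on D. f x * cnj (\<phi> n x)) \<longlonglongrightarrow> (LINT x|lebesgue_on D. f x * cnj (v x))"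
    by (intro L2_inner_tendsto f L \<phi>(2)) (use H10_grad_L2[OF vk] in auto)
  ultimately show ?thesis by (simp add: LIMSEQ_unique)
qed

lemma integral_mult_cnj_swap: "(LINT x|M. f x * cnj (g x)) = cnj (LINT x|M. g x * cnj (f x))"
  unfolding Bochner_Integration.integral_cnj[symmetric] by (simp add: mult.commute)

text \<open>Testing each weak equation with the other function gives the same Hermitian form in the
  two gradients. Membership in \<open>H10_grad D\<close> replaces the vanishing of boundary
  terms.\<close>

lemma neg_dirichlet_laplacian_symmetric:
  assumes D: "D \<in> sets lebesgue"
    and uf: "(u, f) \<in> neg_dirichlet_laplacian D" and vh: "(v, h) \<in> neg_dirichlet_laplacian D"
  shows "(LINT x|lebesgue_on D. f x * cnj (v x)) = (LINT x|lebesgue_on D. u x * cnj (h x))"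
proof -
  obtain g where g: "(u, g) \<in> H10_grad D" "f \<in> L2 D" "\<And>\<phi>. \<phi> \<in> test_functions D \<Longrightarrow>
      (LINT x|lebesgue_on D. (\<Sum>i\<in>UNIV. g i x * cnj (partial_deriv i \<phi> x)))
        = (LINT x|lebesgue_on D. f x * cnj (\<phi> x))"
    using uf unfolding neg_dirichlet_laplacian_def by blast
  obtain k where k: "(v, k) \<in> H10_grad D" "h \<in> L2 D" "\<And>\<phi>. \<phi> \<in> test_functions D \<Longrightarrow>
      (LINT x|lebesgue_on D. (\<Sum>i\<in>UNIV. k i x * cnj (partial_deriv i \<phi> x)))
        = (LINT x|lebesgue_on D. h x * cnj (\<phi> x))"
    using vh unfolding neg_dirichlet_laplacian_def by blast
  have "(LINT x|lebesgue_on D. f x * cnj (v x)) = (\<Sum>i\<in>UNIV. LINT x|lebesgue_on D. g i x * cnj (k i x))"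
    by (rule dirichlet_form_extends_to_H10[symmetric, OF D g(2) _ g(3) k(1)])
      (use H10_grad_L2[OF g(1)] in auto)
  also have "\<dots> = cnj (\<Sum>i\<in>UNIV. LINT x|lebesgue_on D. k i x * cnj (g i x))"
    unfolding cnj_sum by (intro sum.cong refl integral_mult_cnj_swap)
  also have "\<dots> = cnj (LINT x|lebesgue_on D. h x * cnj (u x))"
    by (subst dirichlet_form_extends_to_H10[OF D k(2) _ k(3) g(1)])
      (use H10_grad_L2[OF k(1)] in auto)
  finally show ?thesis by (simp add: integral_mult_cnj_swap[of _ u])
qed

section \<open>Linearity of the Dirichlet Laplacian\<close>

lemma H10_grad_add:
  assumes D: "D \<in> sets lebesgue" and "(u, g) \<in> H10_grad D" "(v, k) \<in> H10_grad D"
  shows "(\<lambda>x. u x + v x, \<lambda>i x. g i x + k i x) \<in> H10_grad D"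
proof -
  obtain \<phi> where \<phi>: "\<And>n::nat. \<phi> n \<in> test_functions D"
    "(\<lambda>n. L2_norm_on D (\<lambda>x. \<phi> n x - u x)) \<longlonglongrightarrow> 0"
    "\<And>i. (\<lambda>n. L2_norm_on D (\<lambda>x. partial_deriv i (\<phi> n) x - g i x)) \<longlonglongrightarrow> 0"
    using assms(2) unfolding H10_grad_def by blast
  obtain \<psi> where \<psi>: "\<And>n::nat. \<psi> n \<in> test_functions D"
    "(\<lambda>n. L2_norm_on D (\<lambda>x. \<psi> n x - v x)) \<longlonglongrightarrow> 0"
    "\<And>i. (\<lambda>n. L2_norm_on D (\<lambda>x. partial_deriv i (\<psi> n) x - k i x)) \<longlonglongrightarrow> 0"
    using assms(3) unfolding H10_grad_def by blast
  have uL: "u \<in> L2 D" "\<And>i. g i \<in> L2 D" and vL: "v \<in> L2 D" "\<And>i. k i \<in> L2 D"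
    using H10_grad_L2 assms by blast+
  note L = test_functions_L2[OF D \<phi>(1)] test_functions_L2[OF D \<psi>(1)]
  have conv: "(\<lambda>n. L2_norm_on D (\<lambda>x. (a n x + b n x) - (a' x + b' x))) \<longlonglongrightarrow> 0"
    if "(\<lambda>n. L2_norm_on D (\<lambda>x. a n x - a' x)) \<longlonglongrightarrow> 0" "(\<lambda>n. L2_norm_on D (\<lambda>x. b n x - b' x)) \<longlonglongrightarrow> 0"
      "\<And>n::nat. a n \<in> L2 D" "\<And>n. b n \<in> L2 D" "a' \<in> L2 D" "b' \<in> L2 D" for a b a' b'
  proof (rule tendsto_sandwich[OF _ _ tendsto_const])
    show "(\<lambda>n. L2_norm_on D (\<lambda>x. a n x - a' x) + L2_norm_on D (\<lambda>x. b n x - b' x)) \<longlonglongrightarrow> 0"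
      using tendsto_add[OF that(1,2)] by simp
    have "L2_norm_on D (\<lambda>x. (a n x + b n x) - (a' x + b' x))
        \<le> L2_norm_on D (\<lambda>x. a n x - a' x) + L2_norm_on D (\<lambda>x. b n x - b' x)" for n
      using L2_norm_on_triangle[OF L2_diff[OF that(3)[of n] that(5)] L2_diff[OF that(4)[of n] that(6)]]
      by (simp add: algebra_simps)
    then show "\<forall>\<^sub>F n in sequentially. L2_norm_on D (\<lambda>x. (a n x + b n x) - (a' x + b' x))
        \<le> L2_norm_on D (\<lambda>x. a n x - a' x) + L2_norm_on D (\<lambda>x. b n x - b' x)"
      by (intro always_eventually allI)
  qed simp
  have pd: "partial_deriv i (\<lambda>x. \<phi> n x + \<psi> n x) x = partial_deriv i (\<phi> n) x + partial_deriv i (\<psi> n) x" for i n x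
    by (intro partial_deriv_add test_functions_differentiable[OF \<phi>(1)] test_functions_differentiable[OF \<psi>(1)])
  show ?thesis
    unfolding H10_grad_def mem_Collect_eq prod.case
  proof (intro conjI allI exI[of _ "\<lambda>n x. \<phi> n x + \<psi> n x"])
    show "(\<lambda>x. u x + v x) \<in> L2 D" by (intro L2_add uL vL)
    show "(\<lambda>x. g i x + k i x) \<in> L2 D" for i by (intro L2_add uL vL)
    show "(\<lambda>x. \<phi> n x + \<psi> n x) \<in> test_functions D" for n by (intro test_functions_add \<phi> \<psi>)
    show "(\<lambda>n. L2_norm_on D (\<lambda>x. \<phi> n x + \<psi> n x - (u x + v x))) \<longlonglongrightarrow> 0"
      by (rule conv[OF \<phi>(2) \<psi>(2) L(1) L(3) uL(1) vL(1)])
    show "(\<lambda>n. L2_norm_on D (\<lambda>x. partial_deriv i (\<lambda>x. \<phi> n x + \<psi> n x) x - (g i x + k i x))) \<longlonglongrightarrow> 0" for i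
      unfolding pd by (rule conv[OF \<phi>(3) \<psi>(3) L(2) L(4) uL(2) vL(2)])
  qed
qed

lemma H10_grad_cmult:
  assumes D: "D \<in> sets lebesgue" and "(u, g) \<in> H10_grad D"
  shows "(\<lambda>x. c * u x, \<lambda>i x. c * g i x) \<in> H10_grad D"
proof -
  obtain \<phi> where \<phi>: "\<And>n::nat. \<phi> n \<in> test_functions D"
    "(\<lambda>n. L2_norm_on D (\<lambda>x. \<phi> n x - u x)) \<longlonglongrightarrow> 0"
    "\<And>i. (\<lambda>n. L2_norm_on D (\<lambda>x. partial_deriv i (\<phi> n) x - g i x)) \<longlonglongrightarrow> 0"
    using assms(2) unfolding H10_grad_def by blast
  have pd: "partial_deriv i (\<lambda>x. c * \<phi> n x) x = c * partial_deriv i (\<phi> n) x" for i n x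
    by (intro partial_deriv_cmult test_functions_differentiable[OF \<phi>(1)])
  have uL: "u \<in> L2 D" "\<And>i. g i \<in> L2 D" using H10_grad_L2 assms by blast+
  show ?thesis
    unfolding H10_grad_def mem_Collect_eq prod.case
  proof (intro conjI allI exI[of _ "\<lambda>n x. c * \<phi> n x"] test_functions_cmult \<phi>(1) L2_cmult uL)
    show "(\<lambda>n. L2_norm_on D (\<lambda>x. c * \<phi> n x - c * u x)) \<longlonglongrightarrow> 0"
      using tendsto_mult_right_zero[OF \<phi>(2), of "cmod c"]
      unfolding right_diff_distrib[symmetric] L2_norm_on_cmult .
    show "(\<lambda>n. L2_norm_on D (\<lambda>x. partial_deriv i (\<lambda>x. c * \<phi> n x) x - c * g i x)) \<longlonglongrightarrow> 0" for i
      using tendsto_mult_right_zero[OF \<phi>(3), of "cmod c" i]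
      unfolding pd right_diff_distrib[symmetric] L2_norm_on_cmult .
  qed
qed

lemma neg_dirichlet_laplacian_add:
  assumes D: "D \<in> sets lebesgue"
    and uf: "(u, f) \<in> neg_dirichlet_laplacian D" and vh: "(v, h) \<in> neg_dirichlet_laplacian D"
  shows "(\<lambda>x. u x + v x, \<lambda>x. f x + h x) \<in> neg_dirichlet_laplacian D"
proof -
  obtain g where g: "(u, g) \<in> H10_grad D" "f \<in> L2 D" "\<And>\<phi>. \<phi> \<in> test_functions D \<Longrightarrow>
      (LINT x|lebesgue_on D. (\<Sum>i\<in>UNIV. g i x * cnj (partial_deriv i \<phi> x)))
        = (LINT x|lebesgue_on D. f x * cnj (\<phi> x))"
    using uf unfolding neg_dirichlet_laplacian_def by blast
  obtain k where k: "(v, k) \<in> H10_grad D" "h \<in> L2 D" "\<And>\<phi>. \<phi> \<in> test_functions D \<Longrightarrow>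
      (LINT x|lebesgue_on D. (\<Sum>i\<in>UNIV. k i x * cnj (partial_deriv i \<phi> x)))
        = (LINT x|lebesgue_on D. h x * cnj (\<phi> x))"
    using vh unfolding neg_dirichlet_laplacian_def by blast
  have gL: "\<And>i. g i \<in> L2 D" and kL: "\<And>i. k i \<in> L2 D" using H10_grad_L2 g(1) k(1) by blast+
  have weak: "(LINT x|lebesgue_on D. (\<Sum>i\<in>UNIV. (g i x + k i x) * cnj (partial_deriv i \<phi> x)))
        = (LINT x|lebesgue_on D. (f x + h x) * cnj (\<phi> x))" if \<phi>: "\<phi> \<in> test_functions D" for \<phi>
  proof -
    note L = test_functions_L2[OF D \<phi>]
    have "(LINT x|lebesgue_on D. (\<Sum>i\<in>UNIV. (g i x + k i x) * cnj (partial_deriv i \<phi> x)))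
        = (LINT x|lebesgue_on D. (\<Sum>i\<in>UNIV. g i x * cnj (partial_deriv i \<phi> x))
            + (\<Sum>i\<in>UNIV. k i x * cnj (partial_deriv i \<phi> x)))"
      by (simp only: distrib_right sum.distrib)
    also have "\<dots> = (LINT x|lebesgue_on D. f x * cnj (\<phi> x)) + (LINT x|lebesgue_on D. h x * cnj (\<phi> x))"
      unfolding g(3)[OF \<phi>, symmetric] k(3)[OF \<phi>, symmetric]
      by (intro Bochner_Integration.integral_add Bochner_Integration.integrable_sum
          L2_integrable_mult_cnj L gL kL)
    also have "\<dots> = (LINT x|lebesgue_on D. f x * cnj (\<phi> x) + h x * cnj (\<phi> x))"
      by (intro Bochner_Integration.integral_add[symmetric] L2_integrable_mult_cnj L g k)
    finally show ?thesis by (simp only: distrib_right)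
  qed
  show ?thesis
    unfolding neg_dirichlet_laplacian_def mem_Collect_eq prod.case
    by (intro conjI ballI L2_add g(2) k(2) exI[of _ "\<lambda>i x. g i x + k i x"]
        H10_grad_add[OF D g(1) k(1)] weak)
qed

lemma neg_dirichlet_laplacian_cmult:
  assumes D: "D \<in> sets lebesgue" and uf: "(u, f) \<in> neg_dirichlet_laplacian D"
  shows "(\<lambda>x. c * u x, \<lambda>x. c * f x) \<in> neg_dirichlet_laplacian D"
proof -
  obtain g where g: "(u, g) \<in> H10_grad D" "f \<in> L2 D" "\<And>\<phi>. \<phi> \<in> test_functions D \<Longrightarrow>
      (LINT x|lebesgue_on D. (\<Sum>i\<in>UNIV. g i x * cnj (partial_deriv i \<phi> x)))
        = (LINT x|lebesgue_on D. f x * cnj (\<phi> x))"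
    using uf unfolding neg_dirichlet_laplacian_def by blast
  have weak: "(LINT x|lebesgue_on D. (\<Sum>i\<in>UNIV. c * g i x * cnj (partial_deriv i \<phi> x)))
        = (LINT x|lebesgue_on D. c * f x * cnj (\<phi> x))" if \<phi>: "\<phi> \<in> test_functions D" for \<phi>
    unfolding mult.assoc sum_distrib_left[symmetric] integral_mult_right_zero g(3)[OF \<phi>] ..
  show ?thesis
    unfolding neg_dirichlet_laplacian_def mem_Collect_eq prod.case
    by (intro conjI ballI L2_cmult g(2) exI[of _ "\<lambda>i x. c * g i x"]
        H10_grad_cmult[OF D g(1)] weak)
qed

section \<open>Linearity and symmetry of Schroedinger operators\<close>

lemma dirichlet_schroedinger_L2: "(u, f) \<in> dirichlet_schroedinger D V \<Longrightarrow> u \<in> L2 D \<and> f \<in> L2 D"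
  using neg_dirichlet_laplacian_L2 by (fastforce simp: dirichlet_schroedinger_def)

lemma dirichlet_schroedinger_add:
  assumes D: "D \<in> sets lebesgue"
    and uf: "(u, f) \<in> dirichlet_schroedinger D V" and vk: "(v, k) \<in> dirichlet_schroedinger D V"
  shows "(\<lambda>x. u x + v x, \<lambda>x. f x + k x) \<in> dirichlet_schroedinger D V"
proof -
  obtain h where h: "(u, h) \<in> neg_dirichlet_laplacian D" "f \<in> L2 D" "(\<lambda>x. complex_of_real (V x) * u x) \<in> L2 D"
      "AE x in lebesgue_on D. f x = h x + complex_of_real (V x) * u x"
    using uf unfolding dirichlet_schroedinger_def by blast
  obtain l where l: "(v, l) \<in> neg_dirichlet_laplacian D" "k \<in> L2 D" "(\<lambda>x. complex_of_real (V x) * v x) \<in> L2 D"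
      "AE x in lebesgue_on D. k x = l x + complex_of_real (V x) * v x"
    using vk unfolding dirichlet_schroedinger_def by blast
  have "AE x in lebesgue_on D. f x + k x = (h x + l x) + complex_of_real (V x) * (u x + v x)"
    using h(4) l(4) by eventually_elim (simp add: algebra_simps)
  then show ?thesis
    unfolding dirichlet_schroedinger_def
    using neg_dirichlet_laplacian_add[OF D h(1) l(1)] L2_add[OF h(2) l(2)] L2_add[OF h(3) l(3)]
    by (auto simp: distrib_left)
qed

lemma dirichlet_schroedinger_cmult:
  assumes D: "D \<in> sets lebesgue" and uf: "(u, f) \<in> dirichlet_schroedinger D V"
  shows "(\<lambda>x. c * u x, \<lambda>x. c * f x) \<in> dirichlet_schroedinger D V"
proof -
  obtain h where h: "(u, h) \<in> neg_dirichlet_laplacian D" "f \<in> L2 D" "(\<lambda>x. complex_of_real (V x) * u x) \<in> L2 D"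
      "AE x in lebesgue_on D. f x = h x + complex_of_real (V x) * u x"
    using uf unfolding dirichlet_schroedinger_def by blast
  have "AE x in lebesgue_on D. c * f x = c * h x + complex_of_real (V x) * (c * u x)"
    using h(4) by eventually_elim (simp add: algebra_simps)
  moreover have "(\<lambda>x. complex_of_real (V x) * (c * u x)) \<in> L2 D"
    using L2_cmult[OF h(3), of c] by (simp add: mult.left_commute)
  ultimately show ?thesis
    unfolding dirichlet_schroedinger_def
    using neg_dirichlet_laplacian_cmult[OF D h(1), of c] L2_cmult[OF h(2), of c] by auto
qed

lemma dirichlet_schroedinger_symmetric:
  assumes D: "D \<in> sets lebesgue"
    and uf: "(u, f) \<in> dirichlet_schroedinger D V" and vk: "(v, k) \<in> dirichlet_schroedinger D V"
  shows "(LINT x|lebesgue_on D. f x * cnj (v x)) = (LINT x|lebesgue_on D. u x * cnj (k x))"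
proof -
  obtain h where h: "(u, h) \<in> neg_dirichlet_laplacian D" "f \<in> L2 D" "(\<lambda>x. complex_of_real (V x) * u x) \<in> L2 D"
      "AE x in lebesgue_on D. f x = h x + complex_of_real (V x) * u x"
    using uf unfolding dirichlet_schroedinger_def by blast
  obtain l where l: "(v, l) \<in> neg_dirichlet_laplacian D" "k \<in> L2 D" "(\<lambda>x. complex_of_real (V x) * v x) \<in> L2 D"
      "AE x in lebesgue_on D. k x = l x + complex_of_real (V x) * v x"
    using vk unfolding dirichlet_schroedinger_def by blast
  have L: "u \<in> L2 D" "h \<in> L2 D" "v \<in> L2 D" "l \<in> L2 D"
    using neg_dirichlet_laplacian_L2 h(1) l(1) by blast+
  note int = L2_integrable_mult_cnj[THEN borel_measurable_integrable]
  \<comment> \<open>The Laplacian and the potential term are separately square-integrable, so the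
    integral splits. The first part is symmetric, and the real factor \<open>V\<close> passes
    through the conjugation in the second.\<close>
  have "(LINT x|lebesgue_on D. f x * cnj (v x))
      = (LINT x|lebesgue_on D. h x * cnj (v x) + complex_of_real (V x) * u x * cnj (v x))"
    by (rule integral_cong_AE)
      (use h(4) in \<open>auto intro!: int L h borel_measurable_add simp: distrib_right\<close>)
  also have "\<dots> = (LINT x|lebesgue_on D. h x * cnj (v x)) + (LINT x|lebesgue_on D. complex_of_real (V x) * u x * cnj (v x))"
    by (intro Bochner_Integration.integral_add L2_integrable_mult_cnj L h)
  also have "\<dots> = (LINT x|lebesgue_on D. u x * cnj (l x)) + (LINT x|lebesgue_on D. u x * cnj (complex_of_real (V x) * v x))"
    unfolding neg_dirichlet_laplacian_symmetric[OF D h(1) l(1)] by (simp add: algebra_simps)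
  also have "\<dots> = (LINT x|lebesgue_on D. u x * cnj (l x) + u x * cnj (complex_of_real (V x) * v x))"
    by (intro Bochner_Integration.integral_add[symmetric] L2_integrable_mult_cnj L l)
  also have "\<dots> = (LINT x|lebesgue_on D. u x * cnj (k x))"
  proof (rule integral_cong_AE)
    show "AE x in lebesgue_on D. u x * cnj (l x) + u x * cnj (complex_of_real (V x) * v x) = u x * cnj (k x)"
      using l(4) by eventually_elim (simp add: distrib_left)
  qed (intro int L l borel_measurable_add)+
  finally show ?thesis .
qed

section \<open>Translations\<close>

context
  fixes a :: "real^'d" and D :: "(real^'d) set"
  assumes D: "D \<in> sets lebesgue"
begin

lemma translated_set: "(+) a ` D \<in> sets lebesgue"
  by (rule lebesgue_sets_translation[OF D])

lemma translation_vimage: "X \<subseteq> D \<Longrightarrow> (\<lambda>x. x - a) -` X \<inter> (+) a ` D = (+) a ` X"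
  by force

lemma translation_measurable:
  "(\<lambda>x. x - a) \<in> lebesgue_on ((+) a ` D) \<rightarrow>\<^sub>M lebesgue_on D"
proof (rule measurableI)
  fix X assume X: "X \<in> sets (lebesgue_on D)"
  then have "X \<subseteq> D" "X \<in> sets lebesgue"
    using D by (auto simp: sets_restrict_space)
  then show "(\<lambda>x. x - a) -` X \<inter> space (lebesgue_on ((+) a ` D)) \<in> sets (lebesgue_on ((+) a ` D))"
    using translated_set lebesgue_sets_translation[of X a]
    by (auto simp: translation_vimage sets_restrict_space_iff)
qed auto

text \<open>Translation invariance of Lebesgue measure as a push-forward identity, from which the
  transfer of integrals, null sets and \<open>L2\<close> is read off.\<close>

lemma distr_translation:
  "distr (lebesgue_on ((+) a ` D)) (lebesgue_on D) (\<lambda>x. x - a) = lebesgue_on D"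
proof (rule measure_eqI)
  fix X assume "X \<in> sets (distr (lebesgue_on ((+) a ` D)) (lebesgue_on D) (\<lambda>x. x - a))"
  then have XD: "X \<in> sets (lebesgue_on D)" by simp
  then have X: "X \<subseteq> D" "X \<in> sets lebesgue"
    using D by (auto simp: sets_restrict_space)
  have "emeasure (distr (lebesgue_on ((+) a ` D)) (lebesgue_on D) (\<lambda>x. x - a)) X
      = emeasure (lebesgue_on ((+) a ` D)) ((+) a ` X)"
    using emeasure_distr[OF translation_measurable XD] X by (simp add: translation_vimage)
  also have "\<dots> = emeasure lebesgue ((+) a ` X)"
    using X translated_set by (intro emeasure_restrict_space) auto
  also have "\<dots> = emeasure lebesgue X"
    using emeasure_lebesgue_affine[of 1 a X] by (simp add: add.commute cong: image_cong_simp)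
  also have "\<dots> = emeasure (lebesgue_on D) X"
    using X D by (intro emeasure_restrict_space[symmetric]) auto
  finally show "emeasure (distr (lebesgue_on ((+) a ` D)) (lebesgue_on D) (\<lambda>x. x - a)) X
      = emeasure (lebesgue_on D) X" .
qed simp

lemma measurable_translation_compose:
  "f \<in> borel_measurable (lebesgue_on D) \<Longrightarrow>
    (\<lambda>x. f (x - a)) \<in> borel_measurable (lebesgue_on ((+) a ` D))"
  by (rule measurable_compose[OF translation_measurable])

lemma integral_translation:
  fixes f :: "real^'d \<Rightarrow> 'b::{banach, second_countable_topology}"
  assumes "f \<in> borel_measurable (lebesgue_on D)"
  shows "(LINT x|lebesgue_on ((+) a ` D). f (x - a)) = (LINT x|lebesgue_on D. f x)"
  using integral_distr[OF translation_measurable assms] by (simp add: distr_translation)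

lemma AE_translation:
  assumes "AE x in lebesgue_on D. P x"
  shows "AE x in lebesgue_on ((+) a ` D). P (x - a)"
  using assms by (intro AE_distrD[OF translation_measurable]) (simp only: distr_translation)

lemma L2_translation:
  assumes "f \<in> L2 D"
  shows "(\<lambda>x. f (x - a)) \<in> L2 ((+) a ` D)"
proof -
  have "integrable (lebesgue_on ((+) a ` D)) (\<lambda>x. (cmod (f (x - a)))\<^sup>2)"
    by (rule integrable_distr[OF translation_measurable])
      (simp add: distr_translation L2_integrable_cmod_square[OF assms])
  then show ?thesis
    using measurable_translation_compose[OF L2_measurable[OF assms]] by (simp add: L2_def)
qed

lemma L2_norm_on_translation:
  assumes "f \<in> L2 D"
  shows "L2_norm_on ((+) a ` D) (\<lambda>x. f (x - a)) = L2_norm_on D f"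
  unfolding L2_norm_on_def
  using integral_translation[OF borel_measurable_integrable[OF L2_integrable_cmod_square[OF assms]]]
  by simp

end

lemma test_functions_translation:
  assumes "\<phi> \<in> test_functions D"
  shows "(\<lambda>x. \<phi> (x - a)) \<in> test_functions ((+) a ` D)"
proof -
  have "{x. \<phi> (x - a) \<noteq> 0} = (+) a ` {x. \<phi> x \<noteq> 0}"
    by (force simp: image_iff algebra_simps intro: exI[of _ "_ - a"])
  then have "closure {x. \<phi> (x - a) \<noteq> 0} = (+) a ` closure {x. \<phi> x \<noteq> 0}"
    by (simp add: closure_translation)
  moreover have "times_differentiable k (\<lambda>x. \<phi> (x - a))" for k
    using times_differentiable_shift[of k \<phi> "- a"] assms by (simp add: test_functions_def)
  ultimately show ?thesis
    using assms compact_translation[of "closure {x. \<phi> x \<noteq> 0}" a]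
    by (simp add: test_functions_def image_mono del: compact_closure)
qed

lemma partial_deriv_translation:
  assumes "\<phi> \<in> test_functions D"
  shows "partial_deriv i (\<lambda>x. \<phi> (x - a)) x = partial_deriv i \<phi> (x - a)"
  using partial_deriv_shift[of \<phi> x "- a" i] test_functions_differentiable[OF assms] by simp

lemma H10_grad_translation:
  assumes D: "D \<in> sets lebesgue" and ug: "(u, g) \<in> H10_grad D"
  shows "(\<lambda>x. u (x - a), \<lambda>i x. g i (x - a)) \<in> H10_grad ((+) a ` D)"
proof -
  obtain \<phi> where \<phi>: "\<And>n::nat. \<phi> n \<in> test_functions D"
    "(\<lambda>n. L2_norm_on D (\<lambda>x. \<phi> n x - u x)) \<longlonglongrightarrow> 0"
    "\<And>i. (\<lambda>n. L2_norm_on D (\<lambda>x. partial_deriv i (\<phi> n) x - g i x)) \<longlonglongrightarrow> 0"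
    using ug unfolding H10_grad_def by blast
  have uL: "u \<in> L2 D" "\<And>i. g i \<in> L2 D" using H10_grad_L2[OF ug] by blast+
  note L = test_functions_L2[OF D \<phi>(1)]
  show ?thesis
    unfolding H10_grad_def mem_Collect_eq prod.case
  proof (intro conjI allI exI[of _ "\<lambda>n x. \<phi> n (x - a)"] test_functions_translation \<phi>(1)
      L2_translation D uL)
    show "(\<lambda>n. L2_norm_on ((+) a ` D) (\<lambda>x. \<phi> n (x - a) - u (x - a))) \<longlonglongrightarrow> 0"
      using \<phi>(2) L2_norm_on_translation[OF D L2_diff[OF L(1) uL(1)]] by simp
    show "(\<lambda>n. L2_norm_on ((+) a ` D) (\<lambda>x. partial_deriv i (\<lambda>x. \<phi> n (x - a)) x - g i (x - a))) \<longlonglongrightarrow> 0" for i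
      using \<phi>(3)[of i] L2_norm_on_translation[OF D L2_diff[OF L(2) uL(2)]]
      unfolding partial_deriv_translation[OF \<phi>(1)] by simp
  qed
qed

text \<open>The Laplacian has constant coefficients: a test function on the translated set is pulled
  back to \<theta> on \<open>D\<close>, and a change of variables carries the weak equation
  over.\<close>

lemma neg_dirichlet_laplacian_translation:
  fixes D :: "(real^'d) set"
  assumes D: "D \<in> sets lebesgue" and uf: "(u, f) \<in> neg_dirichlet_laplacian D"
  shows "(\<lambda>x. u (x - a), \<lambda>x. f (x - a)) \<in> neg_dirichlet_laplacian ((+) a ` D)"
proof -
  let ?D = "(+) a ` D"
  obtain g where g: "(u, g) \<in> H10_grad D" "f \<in> L2 D" "\<And>\<phi>. \<phi> \<in> test_functions D \<Longrightarrow>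
      (LINT x|lebesgue_on D. (\<Sum>i\<in>UNIV. g i x * cnj (partial_deriv i \<phi> x)))
        = (LINT x|lebesgue_on D. f x * cnj (\<phi> x))"
    using uf unfolding neg_dirichlet_laplacian_def by blast
  have gL: "\<And>i. g i \<in> L2 D" using H10_grad_L2[OF g(1)] by blast
  have weak: "(LINT x|lebesgue_on ?D. (\<Sum>i\<in>UNIV. g i (x - a) * cnj (partial_deriv i \<phi> x)))
      = (LINT x|lebesgue_on ?D. f (x - a) * cnj (\<phi> x))" if \<phi>: "\<phi> \<in> test_functions ?D" for \<phi>
  proof -
    define \<theta> where "\<theta> = (\<lambda>x. \<phi> (x - (- a)))"
    have "(+) (- a) ` ?D = D" by (simp add: image_image)
    then have \<theta>: "\<theta> \<in> test_functions D"
      using test_functions_translation[OF \<phi>, of "- a"] by (simp add: \<theta>_def)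
    have \<phi>\<theta>: "\<phi> = (\<lambda>x. \<theta> (x - a))" by (simp add: \<theta>_def)
    note L = test_functions_L2[OF D \<theta>]
    note meas = borel_measurable_integrable[OF L2_integrable_mult_cnj]
    have "(LINT x|lebesgue_on ?D. (\<Sum>i\<in>UNIV. g i (x - a) * cnj (partial_deriv i \<phi> x)))
        = (LINT x|lebesgue_on ?D. (\<Sum>i\<in>UNIV. g i (x - a) * cnj (partial_deriv i \<theta> (x - a))))"
      unfolding \<phi>\<theta> partial_deriv_translation[OF \<theta>] ..
    also have "\<dots> = (LINT x|lebesgue_on D. (\<Sum>i\<in>UNIV. g i x * cnj (partial_deriv i \<theta> x)))"
      by (rule integral_translation[OF D]) (intro borel_measurable_sum meas gL L)
    also have "\<dots> = (LINT x|lebesgue_on D. f x * cnj (\<theta> x))" by (rule g(3)[OF \<theta>])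
    also have "\<dots> = (LINT x|lebesgue_on ?D. f (x - a) * cnj (\<theta> (x - a)))"
      by (rule integral_translation[OF D, symmetric]) (intro meas g L)
    finally show ?thesis unfolding \<phi>\<theta> .
  qed
  show ?thesis
    unfolding neg_dirichlet_laplacian_def mem_Collect_eq prod.case
    by (intro conjI ballI L2_translation D g(2) exI[of _ "\<lambda>i x. g i (x - a)"]
        H10_grad_translation g(1) weak)
qed

section \<open>Potentials and thin sets\<close>

text \<open>A finite partial sum is at most \<open>m\<close> times a partial sum of the nonnegative
  \<open>u j x\<close>, hence at most \<open>m * c\<close>, and the bound passes to the limit. It
  holds at the given point, without exceptional sets.\<close>

lemma random_potential_bound:
  fixes u :: "int^'d \<Rightarrow> real^'d \<Rightarrow> real"
  assumes u: "\<And>j. 0 \<le> u j x" and \<omega>: "\<And>j. \<bar>\<omega> j\<bar> \<le> m" and m: "0 \<le> m" and c: "0 \<le> c"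
    and U: "potential_sum u x \<le> ennreal c"
  shows "\<bar>random_potential u \<omega> x\<bar> \<le> m * c"
proof (cases "(\<lambda>j. \<omega> j * u j x) summable_on UNIV")
  case True
  have bound: "norm (\<Sum>j\<in>F. \<omega> j * u j x) \<le> m * c" if F: "finite F" for F
  proof -
    have "ennreal (\<Sum>j\<in>F. u j x) = (\<Sum>j\<in>F. ennreal (u j x))" using u by (simp add: sum_ennreal)
    also have "\<dots> \<le> potential_sum u x"
      unfolding potential_sum_def using F by (subst nonneg_infsum_complete) (auto intro: SUP_upper)
    finally have "(\<Sum>j\<in>F. u j x) \<le> c" using U c by (simp add: order_trans[of _ "potential_sum u x"] flip: ennreal_le_iff)
    have "norm (\<Sum>j\<in>F. \<omega> j * u j x) \<le> (\<Sum>j\<in>F. norm (\<omega> j * u j x))" by (rule norm_sum)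
    also have "\<dots> \<le> (\<Sum>j\<in>F. m * u j x)"
      using u \<omega> by (intro sum_mono) (simp add: abs_mult mult_right_mono)
    also have "\<dots> \<le> m * c"
      unfolding sum_distrib_left[symmetric] by (intro mult_left_mono \<open>(\<Sum>j\<in>F. u j x) \<le> c\<close> m)
    finally show ?thesis .
  qed
  have "((\<lambda>F. \<Sum>j\<in>F. \<omega> j * u j x) \<longlongrightarrow> random_potential u \<omega> x) (finite_subsets_at_top UNIV)"
    unfolding random_potential_def by (rule infsum_tendsto[OF True])
  then have "norm (random_potential u \<omega> x) \<le> m * c"
  proof (rule Lim_norm_ubound[rotated])
    show "\<forall>\<^sub>F F in finite_subsets_at_top UNIV. norm (\<Sum>j\<in>F. \<omega> j * u j x) \<le> m * c"
      using bound by (intro eventually_finite_subsets_at_top_weakI) auto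
  qed simp
  then show ?thesis by simp
next
  \<comment> \<open>\<open>infsum\<close> takes the value 0 on a family that is not summable, so the
    bound is immediate.\<close>
  case False
  then show ?thesis using m c by (simp add: random_potential_def infsum_not_exists)
qed

text \<open>The sum is an integral over counting measure on a countable index set. Measurability in
  \<open>x\<close> thus becomes measurability of an integral depending on a parameter.\<close>

lemma random_potential_measurable:
  fixes u :: "int^'d \<Rightarrow> real^'d \<Rightarrow> real"
  assumes "\<And>j. u j \<in> borel_measurable lebesgue"
  shows "random_potential u \<omega> \<in> borel_measurable lebesgue"
proof -
  interpret sigma_finite_measure "count_space (UNIV :: (int^'d) set)"
    by (rule sigma_finite_measure_count_space)
  have eq: "random_potential u \<omega> x = (LINT j|count_space UNIV. \<omega> j * u j x)" for x
  proof -
    define f where "f = (\<lambda>j. \<omega> j * u j x)"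
    \<comment> \<open>For real families summability is absolute summability, that is, integrability
      for counting measure. The sum and the integral therefore fall back to their default value 0 in
      the same case.\<close>
    have iff: "f summable_on UNIV \<longleftrightarrow> integrable (count_space UNIV) f"
      using summable_on_iff_abs_summable_on_real[of f UNIV] abs_summable_equivalent[of f UNIV]
        Infinite_Set_Sum.abs_summable_on_def[of f UNIV] by blast
    have "infsum f UNIV = (LINT j|count_space UNIV. f j)"
    proof (cases "integrable (count_space UNIV) f")
      case True
      then show ?thesis
        using infsetsum_infsum[of f UNIV]
        by (simp only: infsetsum_def Infinite_Set_Sum.abs_summable_on_def)
    next
      case False
      then show ?thesis
        using iff by (simp add: infsum_not_exists not_integrable_integral_eq)
    qed
    then show ?thesis by (simp add: random_potential_def f_def)
  qed
  have "(\<lambda>x. LINT j|count_space UNIV. \<omega> j * u j x) \<in> borel_measurable lebesgue"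
  proof (rule borel_measurable_lebesgue_integral)
    have "(\<lambda>z. u (snd z) (fst z)) \<in> borel_measurable (lebesgue \<Otimes>\<^sub>M count_space UNIV)"
      by (rule measurable_compose_countable'[where I=UNIV and g=snd and f="\<lambda>j z. u j (fst z)"])
        (use assms in auto)
    moreover have "(\<lambda>z. \<omega> (snd z)) \<in> borel_measurable (lebesgue \<Otimes>\<^sub>M count_space UNIV)"
      by (rule measurable_compose[OF measurable_snd]) simp
    ultimately show "(\<lambda>(x, j). \<omega> j * u j x) \<in> borel_measurable (lebesgue \<Otimes>\<^sub>M count_space UNIV)"
      unfolding case_prod_beta by (intro borel_measurable_times)
  qed
  then show ?thesis unfolding eq[abs_def] .
qed

section \<open>Cubes, and thin cubes far from the origin\<close>

lemma cube_lmeasurable: "cube L x \<in> lmeasurable"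
  unfolding cube_def by (intro measurable_translation lmeasurable_box)

lemma cube_translation: "cube L x = (+) x ` cube L 0"
  by (simp add: cube_def image_image)

lemma norm_lt_of_mem_cube:
  fixes x :: "real^'d"
  assumes "y \<in> cube L x"
  shows "norm (y - x) < real CARD('d) * L"
proof -
  from assms obtain z where z: "y = x + z" "z \<in> box (vec (- (L / 2))) (vec (L / 2))" by (auto simp: cube_def)
  have zi: "\<bar>z $ i\<bar> < L" for i
    using z(2) by (simp add: mem_box_cart abs_if) (smt (verit, best) field_sum_of_halves)
  have "norm z \<le> (\<Sum>i\<in>UNIV. \<bar>z $ i\<bar>)" by (rule norm_le_l1_cart)
  also have "\<dots> < (\<Sum>i\<in>(UNIV :: 'd set). L)" using zi by (intro sum_strict_mono) auto
  finally show ?thesis using z by simp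
qed

lemma disjoint_cubes:
  fixes x y :: "real^'d"
  assumes "norm (x - y) \<ge> 2 * real CARD('d) * L"
  shows "cube L x \<inter> cube L y = {}"
proof (rule ccontr)
  assume "cube L x \<inter> cube L y \<noteq> {}"
  then obtain z where "z \<in> cube L x" "z \<in> cube L y" by blast
  then have "norm (z - x) < real CARD('d) * L" "norm (z - y) < real CARD('d) * L"
    by (simp_all add: norm_lt_of_mem_cube)
  moreover have "norm (x - y) \<le> norm (z - x) + norm (z - y)"
    using norm_triangle_ineq4[of "z - y" "z - x"] by simp
  ultimately show False using assms by linarith
qed

text \<open>Failure of thickness yields a box of side \<open>T\<close> that meets \<open>S\<close>
  in little measure, but at an uncontrolled place. A box large compared with \<open>R\<close> cannot
  have all its subcubes of side \<open>L\<close> centred near the origin.\<close>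

lemma not_thick_far_thin_cube:
  fixes S :: "(real^'d) set"
  assumes S: "S \<in> sets lebesgue" and thin: "\<not> thick S" and L: "0 < L" and e: "0 < e"
  shows "\<exists>x. R < norm x \<and> measure lebesgue (S \<inter> cube L x) < e"
proof -
  \<comment> \<open>Centres of cubes in opposite corners then differ by
    \<open>T - L = 2 * \<bar>R\<bar> + 1\<close> in each coordinate. The absolute value allows for
    negative \<open>R\<close>.\<close>
  define T where "T = L + 2 * \<bar>R\<bar> + 1"
  define Q where "Q = measure lebesgue (cbox 0 (vec T :: real^'d))"
  \<comment> \<open>The minimum makes \<gamma> admissible in the definition of thickness; the
    quotient ensures \<open>\<gamma> * Q \<le> e\<close>, with \<open>Q + 1\<close> as a safe
    denominator.\<close>
  define \<gamma> where "\<gamma> = min 1 (e / (Q + 1))"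
  have Q0: "Q \<ge> 0" by (simp add: Q_def)
  have \<gamma>: "0 < \<gamma>" "\<gamma> \<le> 1" using Q0 e by (auto simp: \<gamma>_def)
  have "\<gamma> * Q \<le> e / (Q + 1) * Q" using Q0 by (intro mult_right_mono) (auto simp: \<gamma>_def)
  also have "\<dots> \<le> e" using Q0 e by (simp add: field_simps)
  finally have \<gamma>Q: "\<gamma> * Q \<le> e" .
  have T0: "T > 0" using L by (simp add: T_def)
  obtain y where y: "measure lebesgue (S \<inter> (+) y ` cbox 0 (vec T)) < \<gamma> * Q"
    using thin S \<gamma> T0 unfolding thick_def Q_def by (metis not_le vec_component)
  have sub: "cube L (y + vec s) \<subseteq> (+) y ` cbox 0 (vec T)" if "L / 2 \<le> s" "s + L / 2 \<le> T" for s
  proof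
    fix z assume "z \<in> cube L (y + vec s)"
    then obtain w where w: "z = y + (vec s + w)" "w \<in> box (vec (- (L / 2))) (vec (L / 2))"
      by (auto simp: cube_def add.assoc)
    have "0 \<le> s + w $ i \<and> s + w $ i \<le> T" for i
      using w(2) that unfolding mem_box_cart vec_component by (smt (verit))
    then have "vec s + w \<in> cbox 0 (vec T)" by (simp add: mem_box_cart)
    then show "z \<in> (+) y ` cbox 0 (vec T)" using w(1) by blast
  qed
  have small: "measure lebesgue (S \<inter> cube L (y + vec s)) < e" if "L / 2 \<le> s" "s + L / 2 \<le> T" for s
  proof -
    have "measure lebesgue (S \<inter> cube L (y + vec s)) \<le> measure lebesgue (S \<inter> (+) y ` cbox 0 (vec T))"
    proof (rule measure_mono_fmeasurable)
      show "S \<inter> cube L (y + vec s) \<subseteq> S \<inter> (+) y ` cbox 0 (vec T)" using sub[OF that] by blast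
      show "S \<inter> cube L (y + vec s) \<in> sets lebesgue"
        using S cube_lmeasurable by (intro sets.Int) auto
      show "S \<inter> (+) y ` cbox 0 (vec T) \<in> lmeasurable"
        using fmeasurable_Int_fmeasurable[OF measurable_translation[OF lmeasurable_cbox] S]
        by (simp add: Int_commute)
    qed
    then show ?thesis using y \<gamma>Q by linarith
  qed
  txt \<open>Of the subcubes in two opposite corners of the box, one is far from the origin.\<close>
  let ?p = "y + vec (L / 2)" and ?q = "y + vec (T - L / 2)"
  obtain i :: 'd where True by simp
  have "2 * R < norm (?q - ?p)"
  proof -
    have "2 * R < \<bar>(?q - ?p) $ i\<bar>" using L by (simp add: T_def)
    also have "\<dots> \<le> norm (?q - ?p)" by (rule component_le_norm_cart)
    finally show ?thesis .
  qed
  also have "\<dots> \<le> norm ?q + norm ?p" by (rule norm_triangle_ineq4)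
  finally have "R < norm ?p \<or> R < norm ?q" by linarith
  moreover have "measure lebesgue (S \<inter> cube L ?p) < e" "measure lebesgue (S \<inter> cube L ?q) < e"
    using L by (auto intro!: small simp: T_def)
  ultimately show ?thesis by blast
qed

text \<open>The centres are chosen recursively, each norm exceeding the previous one by more than
  \<open>?r\<close>. Norms then increase along the whole sequence, and the reverse triangle
  inequality separates any two centres, not only neighbours.\<close>

lemma infinitely_many_disjoint_cubes:
  fixes P :: "real^'d \<Rightarrow> bool"
  assumes L: "0 \<le> L" and far: "\<And>R. \<exists>x. R < norm x \<and> P x"
  shows "\<exists>x :: nat \<Rightarrow> real^'d. disjoint_family (\<lambda>j. cube L (x j)) \<and> (\<forall>j. P (x j))"
proof -
  let ?r = "2 * real CARD('d) * L"
  have "\<exists>x :: nat \<Rightarrow> real^'d. \<forall>n. P (x n) \<and> norm (x n) + ?r < norm (x (Suc n))"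
    using far by (intro dependent_nat_choice) blast+
  then obtain x :: "nat \<Rightarrow> real^'d" where x: "\<And>n. P (x n)" "\<And>n. norm (x n) + ?r < norm (x (Suc n))" by blast
  have r0: "?r \<ge> 0" using L by simp
  have mono: "norm (x i) + ?r \<le> norm (x j)" if "i < j" for i j
    using that
  proof (induction j)
    case (Suc j)
    have "norm (x i) + ?r \<le> norm (x j) + ?r"
    proof (cases "i = j")
      case False
      then have "norm (x i) + ?r \<le> norm (x j)" using Suc by simp
      then show ?thesis using r0 by linarith
    qed simp
    then show ?case using x(2)[of j] by linarith
  qed simp
  have "cube L (x i) \<inter> cube L (x j) = {}" if "i < j" for i j
  proof (rule disjoint_cubes)
    show "?r \<le> norm (x i - x j)"
      using mono[OF that] norm_triangle_ineq3[of "x i" "x j"] by linarith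
  qed
  then have "disjoint_family (\<lambda>j. cube L (x j))"
    unfolding disjoint_family_on_def by (metis Int_commute linorder_neqE_nat)
  with x(1) show ?thesis by blast
qed

text \<open>Cut \<open>w\<close> at a height \<open>n\<close>: the part \<open>t n\<close> above it
  has integral below \<open>e / 2\<close> by dominated convergence, and the rest contributes at most
  \<open>n\<close> times the measure of \<open>A\<close>. Requiring \<open>fmeasurable\<close>
  excludes sets of infinite measure, to which \<open>measure\<close> assigns 0.\<close>

lemma integral_absolutely_continuous:
  fixes w :: "'a \<Rightarrow> real"
  assumes w: "integrable M w" and w0: "\<And>x. 0 \<le> w x" and e: "0 < e"
  shows "\<exists>d>0. \<forall>A\<in>fmeasurable M. measure M A < d \<longrightarrow> (LINT x|M. indicator A x * w x) < e"
proof -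
  define t where "t = (\<lambda>n::nat. \<lambda>x. indicator {x. real n < w x} x * w x)"
  have meas: "w \<in> borel_measurable M" using w by simp
  have tm: "t n \<in> borel_measurable M" for n
  proof -
    have "(\<lambda>x. if real n < w x then w x else 0) \<in> borel_measurable M" using meas by measurable
    moreover have "t n = (\<lambda>x. if real n < w x then w x else 0)" by (auto simp: t_def)
    ultimately show ?thesis by simp
  qed
  have t_le: "norm (t n x) \<le> w x" "0 \<le> t n x" for n x using w0[of x] by (auto simp: t_def indicator_def)
  have "(\<lambda>n. LINT x|M. t n x) \<longlonglongrightarrow> (LINT x|M. 0)"
  proof (rule integral_dominated_convergence[OF _ tm w])
    have "(\<lambda>n. t n x) \<longlonglongrightarrow> 0" for x
    proof (rule tendsto_eventually)
      obtain N where "w x \<le> real N" using real_arch_simple by blast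
      then show "\<forall>\<^sub>F n in sequentially. t n x = 0"
        by (intro eventually_sequentiallyI[of N]) (auto simp: t_def)
    qed
    then show "AE x in M. (\<lambda>n. t n x) \<longlonglongrightarrow> 0" by simp
    show "AE x in M. norm (t n x) \<le> w x" for n using t_le by simp
  qed simp
  then have "\<forall>\<^sub>F n in sequentially. (LINT x|M. t n x) < e / 2"
    using e by (intro order_tendstoD(2)[where y="LINT x|M. 0"]) auto
  then obtain n where n: "(LINT x|M. t n x) < e / 2"
    by (meson eventually_happens sequentially_bot)
  have ti: "integrable M (t n)"
    by (rule Bochner_Integration.integrable_bound[OF w tm]) (use t_le w0 in auto)
  show ?thesis
  \<comment> \<open>The denominator uses \<open>n + 1\<close> because the cut-off \<open>n\<close>
    may be 0.\<close>
  proof (intro exI[of _ "e / (2 * (real n + 1))"] conjI ballI impI)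
    show "0 < e / (2 * (real n + 1))" using e by simp
    fix A assume A: "A \<in> fmeasurable M" and small: "measure M A < e / (2 * (real n + 1))"
    have Ai: "integrable M (\<lambda>x. real n * indicator A x)"
      using A integrable_real_indicator[of A M] by (intro integrable_mult_right) (auto simp: fmeasurable_def)
    have "(LINT x|M. indicator A x * w x) \<le> (LINT x|M. t n x + real n * indicator A x)"
    proof (rule integral_mono)
      show "integrable M (\<lambda>x. indicator A x * w x)"
        by (rule Bochner_Integration.integrable_bound[OF w])
          (use A w0 meas in \<open>auto simp: indicator_def fmeasurable_def\<close>)
      show "integrable M (\<lambda>x. t n x + real n * indicator A x)"
        by (intro Bochner_Integration.integrable_add ti Ai)
      show "indicator A x * w x \<le> t n x + real n * indicator A x" for x
        using w0[of x] by (auto simp: t_def indicator_def)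
    qed
    also have "\<dots> = (LINT x|M. t n x) + real n * measure M A"
      using ti Ai A by (simp add: fmeasurableD)
    also have "real n * measure M A \<le> (real n + 1) * measure M A" by (simp add: mult_right_mono)
    also have "\<dots> < e / 2" using small by (simp add: field_simps)
    finally show "(LINT x|M. indicator A x * w x) < e" using n by linarith
  qed
qed

text \<open>Off \<open>S\<close> the bound \<open>s\<close> applies and on \<open>S\<close> the
  bound \<open>b\<close>. Adding both majorants everywhere avoids splitting the domain, and only the
  mass of \<psi> on \<open>S\<close> is weighted with \<open>b\<close>.\<close>

lemma small_potential_L2:
  assumes D: "D \<in> sets lebesgue" and S: "S \<in> sets lebesgue" and \<psi>: "\<psi> \<in> L2 D"
    and V: "V \<in> borel_measurable lebesgue" and b: "AE x in lebesgue. \<bar>V x\<bar> \<le> b"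
    and s: "\<And>x. x \<notin> S \<Longrightarrow> \<bar>V x\<bar> \<le> s"
  shows "(\<lambda>x. complex_of_real (V x) * \<psi> x) \<in> L2 D"
    and "(L2_norm_on D (\<lambda>x. complex_of_real (V x) * \<psi> x))\<^sup>2
      \<le> s\<^sup>2 * (L2_norm_on D \<psi>)\<^sup>2 + b\<^sup>2 * (LINT x|lebesgue_on D. indicator S x * (cmod (\<psi> x))\<^sup>2)"
proof -
  let ?w = "\<lambda>x. s\<^sup>2 * (cmod (\<psi> x))\<^sup>2 + b\<^sup>2 * (indicator S x * (cmod (\<psi> x))\<^sup>2)"
  note \<psi>i = L2_integrable_cmod_square[OF \<psi>]
  have ind: "indicator S \<in> borel_measurable (lebesgue_on D)"
    using S by (intro measurable_restrict_space1 borel_measurable_indicator)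
  have Si: "integrable (lebesgue_on D) (\<lambda>x. indicator S x * (cmod (\<psi> x))\<^sup>2 :: real)"
    by (rule Bochner_Integration.integrable_bound[OF \<psi>i
          borel_measurable_times[OF ind borel_measurable_integrable[OF \<psi>i]]])
      (auto simp: indicator_def)
  have wi: "integrable (lebesgue_on D) ?w"
    using \<psi>i Si by (intro Bochner_Integration.integrable_add integrable_mult_right)
  have bD: "AE x in lebesgue_on D. \<bar>V x\<bar> \<le> b"
    using b D by (simp add: AE_restrict_space_iff) (auto elim: eventually_mono)
  have le: "AE x in lebesgue_on D. (cmod (complex_of_real (V x) * \<psi> x))\<^sup>2 \<le> ?w x"
    using bD
  proof eventually_elim
    case (elim x)
    have "(cmod (complex_of_real (V x) * \<psi> x))\<^sup>2 = \<bar>V x\<bar>\<^sup>2 * (cmod (\<psi> x))\<^sup>2"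
      by (simp add: norm_mult power_mult_distrib)
    also have "\<dots> \<le> ?w x"
    proof (cases "x \<in> S")
      case True
      have "\<bar>V x\<bar>\<^sup>2 * (cmod (\<psi> x))\<^sup>2 \<le> b\<^sup>2 * (cmod (\<psi> x))\<^sup>2"
        using elim by (intro mult_right_mono power_mono) auto
      then show ?thesis using True by (simp add: add_increasing)
    next
      case False
      have "\<bar>V x\<bar>\<^sup>2 * (cmod (\<psi> x))\<^sup>2 \<le> s\<^sup>2 * (cmod (\<psi> x))\<^sup>2"
        using s[OF False] by (intro mult_right_mono power_mono) auto
      then show ?thesis using False by simp
    qed
    finally show ?case .
  qed
  have meas: "(\<lambda>x. complex_of_real (V x) * \<psi> x) \<in> borel_measurable (lebesgue_on D)"
    using measurable_restrict_space1[OF V, of D] L2_measurable[OF \<psi>] by measurable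
  show L: "(\<lambda>x. complex_of_real (V x) * \<psi> x) \<in> L2 D"
    by (rule L2_dominated[OF meas wi le])
  have "(L2_norm_on D (\<lambda>x. complex_of_real (V x) * \<psi> x))\<^sup>2 \<le> (LINT x|lebesgue_on D. ?w x)"
    unfolding L2_norm_on_square by (rule integral_mono_AE[OF L2_integrable_cmod_square[OF L] wi le])
  also have "\<dots> = s\<^sup>2 * (L2_norm_on D \<psi>)\<^sup>2 + b\<^sup>2 * (LINT x|lebesgue_on D. indicator S x * (cmod (\<psi> x))\<^sup>2)"
    unfolding L2_norm_on_square using \<psi>i Si by simp
  finally show "(L2_norm_on D (\<lambda>x. complex_of_real (V x) * \<psi> x))\<^sup>2
      \<le> s\<^sup>2 * (L2_norm_on D \<psi>)\<^sup>2 + b\<^sup>2 * (LINT x|lebesgue_on D. indicator S x * (cmod (\<psi> x))\<^sup>2)" .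
qed

text \<open>The Schroedinger operator minus \<open>E\<close> sends the eigenfunction \<psi> of the
  Laplacian to \<open>V \<psi>\<close>, so the norm of \<open>V \<psi>\<close> measures how good an
  approximate eigenvector \<psi> is.\<close>

lemma dirichlet_schroedinger_spectrum_near:
  assumes D: "D \<in> sets lebesgue"
    and \<psi>: "(\<psi>, f) \<in> neg_dirichlet_laplacian D" "AE x in lebesgue_on D. f x = complex_of_real E * \<psi> x"
    and pos: "0 < L2_norm_on D \<psi>"
    and V: "(\<lambda>x. complex_of_real (V x) * \<psi> x) \<in> L2 D"
    and le: "L2_norm_on D (\<lambda>x. complex_of_real (V x) * \<psi> x) \<le> \<delta> * L2_norm_on D \<psi>"
  shows "spectrum_of D (dirichlet_schroedinger D V) \<inter> complex_of_real ` {E - \<delta> .. E + \<delta>} \<noteq> {}"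
proof (rule symmetric_relation_spectrum_near[OF _ _ _ _ _ pos])
  let ?A = "dirichlet_schroedinger D V" and ?\<eta> = "\<lambda>x. f x + complex_of_real (V x) * \<psi> x"
  have fL: "f \<in> L2 D" and \<psi>L: "\<psi> \<in> L2 D" using neg_dirichlet_laplacian_L2[OF \<psi>(1)] by auto
  have \<eta>L: "?\<eta> \<in> L2 D" by (intro L2_add fL V)
  show "(\<psi>, ?\<eta>) \<in> ?A"
    unfolding dirichlet_schroedinger_def mem_Collect_eq prod.case
    by (intro conjI \<eta>L V exI[of _ f] \<psi>(1) AE_I2 refl)
  have "L2_norm_on D (\<lambda>x. ?\<eta> x - complex_of_real E * \<psi> x) = L2_norm_on D (\<lambda>x. complex_of_real (V x) * \<psi> x)"
  proof (rule L2_norm_on_cong_AE)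
    show "AE x in lebesgue_on D. ?\<eta> x - complex_of_real E * \<psi> x = complex_of_real (V x) * \<psi> x"
      using \<psi>(2) by eventually_elim simp
  qed (intro L2_measurable L2_diff L2_cmult \<eta>L \<psi>L V)+
  with le show "L2_norm_on D (\<lambda>x. ?\<eta> x - complex_of_real E * \<psi> x) \<le> \<delta> * L2_norm_on D \<psi>" by simp
  fix u g v h
  assume ug: "(u, g) \<in> ?A"
  show "u \<in> L2 D \<and> g \<in> L2 D" by (rule dirichlet_schroedinger_L2[OF ug])
  show "(\<lambda>x. c * u x, \<lambda>x. c * g x) \<in> ?A" for c by (rule dirichlet_schroedinger_cmult[OF D ug])
  assume vh: "(v, h) \<in> ?A"
  show "(\<lambda>x. u x + v x, \<lambda>x. g x + h x) \<in> ?A" by (rule dirichlet_schroedinger_add[OF D ug vh])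
  show "(LINT x|lebesgue_on D. g x * cnj (v x)) = (LINT x|lebesgue_on D. u x * cnj (h x))"
    by (rule dirichlet_schroedinger_symmetric[OF D ug vh])
qed

text \<open>The point is that \<open>d\<close> does not depend on the translation \<open>a\<close>:
  moving the set back into \<open>D\<close> preserves its measure and reduces everything to the
  single function \<psi> there.\<close>

lemma L2_translates_absolutely_continuous:
  fixes D :: "(real^'d) set"
  assumes Dm: "D \<in> lmeasurable" and \<psi>: "\<psi> \<in> L2 D" and e: "0 < e"
  shows "\<exists>d>0. \<forall>S\<in>sets lebesgue. \<forall>a. measure lebesgue (S \<inter> (+) a ` D) < d \<longrightarrow>
    (LINT x|lebesgue_on ((+) a ` D). indicator S x * (cmod (\<psi> (x - a)))\<^sup>2) < e"
proof -
  have D: "D \<in> sets lebesgue" using Dm by blast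
  obtain d where d: "d > 0" "\<And>A. A \<in> fmeasurable (lebesgue_on D) \<Longrightarrow> measure (lebesgue_on D) A < d \<Longrightarrow>
      (LINT x|lebesgue_on D. indicator A x * (cmod (\<psi> x))\<^sup>2) < e"
    using integral_absolutely_continuous[OF L2_integrable_cmod_square[OF \<psi>] _ e] by auto
  have "(LINT x|lebesgue_on ((+) a ` D). indicator S x * (cmod (\<psi> (x - a)))\<^sup>2) < e"
    if S: "S \<in> sets lebesgue" and small: "measure lebesgue (S \<inter> (+) a ` D) < d" for S a
  proof -
    define A where "A = (+) (- a) ` (S \<inter> (+) a ` D)"
    have SD: "S \<inter> (+) a ` D \<in> sets lebesgue" using S lebesgue_sets_translation[OF D] by blast
    have AD: "A \<subseteq> D" by (auto simp: A_def)
    have A: "A \<in> sets lebesgue" unfolding A_def by (rule lebesgue_sets_translation[OF SD])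
    have AS: "x - a \<in> A \<longleftrightarrow> x \<in> S" if "x \<in> (+) a ` D" for x
      using that by (force simp: A_def image_iff)
    have "measure (lebesgue_on D) A = measure lebesgue A"
      using D AD A by (intro measure_restrict_space) auto
    then have "measure (lebesgue_on D) A < d" using small unfolding A_def measure_translation by simp
    moreover have "A \<in> fmeasurable (lebesgue_on D)"
      using finite_measure.fmeasurable_eq_sets[OF finite_measure_lebesgue_on[OF Dm]] A AD D
      by (auto simp: sets_restrict_space_iff)
    ultimately have "(LINT x|lebesgue_on D. indicator A x * (cmod (\<psi> x))\<^sup>2) < e" by (rule d(2)[rotated])
    moreover have "(LINT x|lebesgue_on ((+) a ` D). indicator S x * (cmod (\<psi> (x - a)))\<^sup>2)
        = (LINT x|lebesgue_on ((+) a ` D). indicator A (x - a) * (cmod (\<psi> (x - a)))\<^sup>2)"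
      using AS by (intro Bochner_Integration.integral_cong refl) (auto simp: indicator_def)
    moreover have "\<dots> = (LINT x|lebesgue_on D. indicator A x * (cmod (\<psi> x))\<^sup>2)"
    proof (rule integral_translation[OF D])
      have "indicator A \<in> borel_measurable (lebesgue_on D)"
        using A by (intro measurable_restrict_space1 borel_measurable_indicator)
      then show "(\<lambda>x. indicator A x * (cmod (\<psi> x))\<^sup>2) \<in> borel_measurable (lebesgue_on D)"
        using borel_measurable_integrable[OF L2_integrable_cmod_square[OF \<psi>]] by (intro borel_measurable_times)
    qed
    ultimately show ?thesis by simp
  qed
  with d(1) show ?thesis by blast
qed

section \<open>Persistence of Dirichlet eigenvalues on thin cubes\<close>

theorem theorem4:
  fixes m_minus m_plus p :: real
    and \<mu> :: "int^'d \<Rightarrow> real measure"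
    and u :: "int^'d \<Rightarrow> real^'d \<Rightarrow> real"
  assumes "assumption_U m_minus m_plus \<mu>"
    and "assumption_NoPi p u"
  shows "\<forall>L\<ge>1. \<forall>E::real.
    eigenvalue_of (cube L 0) (neg_dirichlet_laplacian (cube L 0 :: (real^'d) set)) (complex_of_real E) \<longrightarrow>
    (\<exists>x :: nat \<Rightarrow> real^'d. disjoint_family (\<lambda>j. cube L (x j)) \<and>
       (\<forall>j. \<forall>\<omega>\<in>space (Pi\<^sub>M UNIV \<mu>).
          spectrum_of (cube L (x j)) (dirichlet_schroedinger (cube L (x j)) (random_potential u \<omega>))
            \<inter> complex_of_real ` {E - exp (- L) .. E + exp (- L)} \<noteq> {}))"
proof (intro allI impI)
  fix L E :: real
  assume L1: "1 \<le> L"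
  let ?D = "cube L 0 :: (real^'d) set"
  assume "eigenvalue_of ?D (neg_dirichlet_laplacian ?D) (complex_of_real E)"
  then obtain \<psi> f where \<psi>: "(\<psi>, f) \<in> neg_dirichlet_laplacian ?D"
    "AE x in lebesgue_on ?D. f x = complex_of_real E * \<psi> x" "\<not> (AE x in lebesgue_on ?D. \<psi> x = 0)"
    unfolding eigenvalue_of_def by blast
  define \<delta> where "\<delta> = exp (- L)"
  have \<delta>: "\<delta> > 0" by (simp add: \<delta>_def)
  \<comment> \<open>Adding 1 makes \<open>m\<close> positive, as the divisions below
    require.\<close>
  define m where "m = max \<bar>m_minus\<bar> \<bar>m_plus\<bar> + 1"
  have m: "m > 0" by (simp add: m_def)
  \<comment> \<open>Each factor space is the interval itself, so the bound holds for every
    configuration and not merely almost surely.\<close>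
  have \<omega>m: "\<bar>\<omega> j\<bar> \<le> m" if "\<omega> \<in> space (Pi\<^sub>M UNIV \<mu>)" for \<omega> j
  proof -
    have "space (\<mu> j) = space (restrict_space borel {m_minus..m_plus})"
      using assms(1) unfolding assumption_U_def by (intro sets_eq_imp_space_eq) blast
    moreover have "\<omega> j \<in> space (\<mu> j)" using that by (auto simp: space_PiM)
    ultimately show ?thesis by (auto simp: m_def space_restrict_space)
  qed
  have u0: "\<And>j x. 0 \<le> u j x" and um: "\<And>j. u j \<in> borel_measurable lebesgue"
    and thin: "\<And>\<kappa>. 0 < \<kappa> \<Longrightarrow> \<not> thick {x. potential_sum u x \<ge> ennreal \<kappa>}"
    using assms(2) unfolding assumption_NoPi_def in_Lp_def by blast+
  obtain C where C: "C > 0" "esssup lebesgue (potential_sum u) \<le> ennreal C"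
    using assms(2) unfolding assumption_NoPi_def by blast
  \<comment> \<open>The essential supremum of a non-measurable function is \<infinity> by
    convention, so its finite bound already yields measurability.\<close>
  have Um: "potential_sum u \<in> borel_measurable lebesgue"
    using C(2) esssup_non_measurable[where f="potential_sum u" and M=lebesgue] by (force simp: top_unique)
  have UC: "AE x in lebesgue. potential_sum u x \<le> ennreal C"
    using esssup_AE[where f="potential_sum u" and M=lebesgue] by eventually_elim (use C(2) in \<open>auto intro: order_trans\<close>)
  have Dm: "?D \<in> lmeasurable" and D: "?D \<in> sets lebesgue"
    using cube_lmeasurable by auto
  have \<psi>L: "\<psi> \<in> L2 ?D" using neg_dirichlet_laplacian_L2[OF \<psi>(1)] by simp
  define N where "N = L2_norm_on ?D \<psi>"
  have N: "N > 0"
    using L2_norm_on_eq_0_iff[OF \<psi>L] \<psi>(3) by (simp add: N_def less_le)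
  \<comment> \<open>Outside \<open>S\<close> the random potential is then at most
    \<open>m * \<kappa> = \<delta> / 2\<close>.\<close>
  define \<kappa> where "\<kappa> = \<delta> / (2 * m)"
  have \<kappa>: "\<kappa> > 0" using \<delta> m by (simp add: \<kappa>_def)
  define S where "S = {x. potential_sum u x \<ge> ennreal \<kappa>}"
  have S: "S \<in> sets lebesgue"
    using measurable_sets[OF Um, of "{ennreal \<kappa>..}"] by (simp add: S_def vimage_def)
  \<comment> \<open>Chosen so that \<open>(m * C)\<^sup>2 * e\<close>, the contribution of
    \<open>S\<close>, equals \<open>(\<delta> * N / 2)\<^sup>2\<close>, matching the contribution
    from outside \<open>S\<close>.\<close>
  define e where "e = (\<delta> * N / (2 * m * C))\<^sup>2"
  have e: "e > 0" using \<delta> N m C by (simp add: e_def)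
  obtain d where d: "d > 0" "\<And>a. measure lebesgue (S \<inter> (+) a ` ?D) < d \<Longrightarrow>
      (LINT x|lebesgue_on ((+) a ` ?D). indicator S x * (cmod (\<psi> (x - a)))\<^sup>2) < e"
    using L2_translates_absolutely_continuous[OF Dm \<psi>L e] S by blast
  \<comment> \<open>The condition on \<open>a\<close> involves only \<open>S\<close> and
    \<open>d\<close>, both fixed before \<omega>, so the same cube works for all
    configurations.\<close>
  have near: "spectrum_of (cube L a) (dirichlet_schroedinger (cube L a) (random_potential u \<omega>))
            \<inter> complex_of_real ` {E - \<delta> .. E + \<delta>} \<noteq> {}"
    if a: "measure lebesgue (S \<inter> cube L a) < d" and \<omega>: "\<omega> \<in> space (Pi\<^sub>M UNIV \<mu>)" for a \<omega>
  proof -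
    let ?\<psi> = "\<lambda>x. \<psi> (x - a)" and ?V = "random_potential u \<omega>"
    note cube = cube_translation[of L a]
    have \<psi>a: "(?\<psi>, \<lambda>x. f (x - a)) \<in> neg_dirichlet_laplacian (cube L a)"
      unfolding cube by (rule neg_dirichlet_laplacian_translation[OF D \<psi>(1)])
    have \<psi>aL: "?\<psi> \<in> L2 (cube L a)" using neg_dirichlet_laplacian_L2[OF \<psi>a] by simp
    have Na: "L2_norm_on (cube L a) ?\<psi> = N"
      unfolding cube N_def by (rule L2_norm_on_translation[OF D \<psi>L])
    have eig: "AE x in lebesgue_on (cube L a). f (x - a) = complex_of_real E * ?\<psi> x"
      unfolding cube by (rule AE_translation[OF D \<psi>(2)])
    have cm: "cube L a \<in> sets lebesgue" using cube_lmeasurable by auto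
    have bound: "\<bar>?V x\<bar> \<le> m * c" if "0 \<le> c" "potential_sum u x \<le> ennreal c" for x c
      by (rule random_potential_bound[OF u0 \<omega>m[OF \<omega>] _ that]) (use m in simp)
    have b: "AE x in lebesgue. \<bar>?V x\<bar> \<le> m * C"
      using UC by eventually_elim (use bound C(1) in auto)
    have s: "\<bar>?V x\<bar> \<le> m * \<kappa>" if "x \<notin> S" for x
      using that \<kappa> by (intro bound) (auto simp: S_def)
    note VL = small_potential_L2[OF cm S \<psi>aL random_potential_measurable[OF um] b s]
    have "(L2_norm_on (cube L a) (\<lambda>x. complex_of_real (?V x) * ?\<psi> x))\<^sup>2 \<le> (m * \<kappa>)\<^sup>2 * N\<^sup>2 + (m * C)\<^sup>2 * e"
      using VL(2) d(2)[of a] a unfolding Na cube[symmetric]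
      by (smt (verit, best) mult_left_mono zero_le_power2)
    also have "\<dots> = (\<delta> * N / 2)\<^sup>2 + (\<delta> * N / 2)\<^sup>2"
      using m C(1) by (simp add: \<kappa>_def e_def power_mult_distrib power_divide)
    also have "\<dots> \<le> (\<delta> * N)\<^sup>2" by (simp add: power_divide)
    finally have "L2_norm_on (cube L a) (\<lambda>x. complex_of_real (?V x) * ?\<psi> x) \<le> \<delta> * N"
      by (rule power2_le_imp_le) (use \<delta> N in simp)
    then show ?thesis
      using N by (intro dirichlet_schroedinger_spectrum_near[OF cm \<psi>a eig _ VL(1)]) (simp_all add: Na)
  qed
  \<comment> \<open>Non-thickness is used only for this one level \<kappa>, with \<open>d\<close> as
    the permitted measure of the intersection.\<close>
  have "\<exists>x. R < norm x \<and> measure lebesgue (S \<inter> cube L x) < d" for R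
    by (rule not_thick_far_thin_cube[OF S _ _ d(1)]) (use thin[OF \<kappa>] L1 in \<open>auto simp: S_def\<close>)
  then have "\<exists>x :: nat \<Rightarrow> real^'d. disjoint_family (\<lambda>j. cube L (x j))
      \<and> (\<forall>j. measure lebesgue (S \<inter> cube L (x j)) < d)"
    using L1 by (intro infinitely_many_disjoint_cubes) auto
  then show "\<exists>x :: nat \<Rightarrow> real^'d. disjoint_family (\<lambda>j. cube L (x j)) \<and>
       (\<forall>j. \<forall>\<omega>\<in>space (Pi\<^sub>M UNIV \<mu>).
          spectrum_of (cube L (x j)) (dirichlet_schroedinger (cube L (x j)) (random_potential u \<omega>))
            \<inter> complex_of_real ` {E - exp (- L) .. E + exp (- L)} \<noteq> {})"
    using near unfolding \<delta>_def by blast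
qed

end
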